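(* Let $E(q)=\prod_{k\ge1}(1-q^k)$ and define $g(n)$ by $\sum_{n\ge0}g(n)q^n=\frac{E(q^2)^5}{E(q)^4}$. Then for all $\alpha\ge1$ and $n\ge0$, $$g\left(3^{2\alpha-1}n+\frac{3^{2\alpha}-1}{4}\right)\equiv0\pmod{3^{2\alpha}}.$$ *)

theory Defs
  imports "HOL-Computational_Algebra.Formal_Power_Series"
begin

text \<open>E(q^a) = prod_{k>=1} (1 - q^(a k)) as a formal power series over the rationals.
  The n-th coefficient of the infinite product is the n-th coefficient of the finite
  product over k = 1..n (later factors do not affect it when a >= 1).\<close>
definition Eq :: "nat \<Rightarrow> rat fps" where
  "Eq a = Abs_fps (\<lambda>n. fps_nth (\<Prod>k\<in>{1..n}. (1 - fps_X ^ (a * k))) n)"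

definition Gfps :: "rat fps" where
  "Gfps = Eq 2 ^ 5 / Eq 1 ^ 4"

definition g :: "nat \<Rightarrow> rat" where
  "g n = fps_nth Gfps n"

end

theory Submission
  imports Defs "HOL-Computational_Algebra.Formal_Laurent_Series"
begin

text \<open>
  Put \<open>\<psi> = E(q\<^sup>2)\<^sup>2 / E(q)\<close> and \<open>\<phi> = E(q)\<^sup>2 / E(q\<^sup>2)\<close>, so that \<open>\<Sum> g(n) q^n = \<psi>\<^sup>2 / \<phi>\<close>. By the Jacobi triple product
  both are theta series, whose 3-dissections are \<open>\<phi>(q) = \<phi>(q^9) (1 - t)\<close> and
  \<open>\<psi>(q) = q \<psi>(q^9) (1 + 2 / t)\<close> with the same \<open>t \<in> q \<rat>[[q\<^sup>3]]\<close>. Let \<open>y = \<phi>(q\<^sup>3)^4 / \<phi>(q)^4\<close> and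
  \<open>z = y(q\<^sup>3)\<close>. Taking the product of \<open>\<phi>\<close> over the substitutions of \<open>q\<close> by its multiples with cube
  roots of unity gives \<open>z (1 - t\<^sup>3) = 1\<close>, hence \<open>y = z\<^sup>3 (1 + t + t\<^sup>2)^4\<close> and the cubic equation
  \<open>y\<^sup>3 = (81 z\<^sup>3 - 108 z\<^sup>2 + 30 z) y\<^sup>2 + (9 z\<^sup>2 - 12 z) y + z\<close>.

  Extracting the exponents in a class modulo 3 from \<open>y^k\<close> or \<open>y^k \<psi>\<^sup>2 / \<phi>\<close> is linear over series in \<open>q\<^sup>3\<close>,
  so this equation is a recursion in \<open>k\<close> which shows that the results are polynomials in \<open>y\<close>
  (times \<open>1\<close> or \<open>\<psi>(q\<^sup>3)\<^sup>2 / \<phi>(q\<^sup>3)\<close>). After rescaling to \<open>Y = 3 y\<close> the recursion has integral coefficients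
  and enough spare factors 3 that every two extraction steps gain a factor 9.
\<close>

subsection \<open>Truncated equality and products of formal power series\<close>

text \<open>Congruence modulo q^n, which stands in for convergence: identities of infinite products
  are proved on truncations for every n and glued by \<open>eq_if_agree\<close>.\<close>

definition agree :: "nat \<Rightarrow> 'a::comm_ring_1 fps \<Rightarrow> 'a fps \<Rightarrow> bool" where
  "agree n f u \<longleftrightarrow> (\<forall>i<n. fps_nth f i = fps_nth u i)"

lemma agree_refl [simp]: "agree n f f"
  by (simp add: agree_def)

lemma agree_sym: "agree n f u \<Longrightarrow> agree n u f"
  by (simp add: agree_def)

lemma agree_trans [trans]: "agree n f u \<Longrightarrow> agree n u h \<Longrightarrow> agree n f h"
  by (simp add: agree_def)

lemma agree_mono: "agree n f u \<Longrightarrow> m \<le> n \<Longrightarrow> agree m f u"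
  by (simp add: agree_def)

lemma agree_add: "agree n f u \<Longrightarrow> agree n f' u' \<Longrightarrow> agree n (f + f') (u + u')"
  by (simp add: agree_def)

lemma agree_mult: "agree n f u \<Longrightarrow> agree n f' u' \<Longrightarrow> agree n (f * f') (u * u')"
  by (auto simp: agree_def fps_mult_nth intro!: sum.cong)

lemma agree_power: "agree n f u \<Longrightarrow> agree n (f ^ k) (u ^ k)"
  by (induction k) (auto intro: agree_mult)

lemma agree_sum: "(\<And>x. x \<in> A \<Longrightarrow> agree n (f x) (u x)) \<Longrightarrow> agree n (sum f A) (sum u A)"
  by (auto simp: agree_def fps_sum_nth intro!: sum.cong)

lemma agree_X_power_mult: "agree n f u \<Longrightarrow> agree (d + n) (fps_X ^ d * f) (fps_X ^ d * u)"
  by (auto simp: agree_def fps_X_power_mult_nth)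

lemma agree_cancel:
  fixes f u h :: "'a::field fps"
  assumes "agree n (f * h) (u * h)" "fps_nth h 0 \<noteq> 0"
  shows "agree n f u"
proof -
  have "agree n (f * h * inverse h) (u * h * inverse h)"
    by (intro agree_mult assms agree_refl)
  thus ?thesis
    using assms(2) by (simp add: mult.assoc inverse_mult_eq_1')
qed

lemma eq_if_agree: "(\<And>n. agree n f u) \<Longrightarrow> f = u"
  unfolding agree_def fps_eq_iff by (meson lessI)

section \<open>Finite q-products and their stabilisation\<close>

text \<open>The q-Pochhammer symbol (-s q^b; q^m)_N; s = -1 gives the factors of E.\<close>

definition fprod :: "'a::comm_ring_1 \<Rightarrow> nat \<Rightarrow> nat \<Rightarrow> nat \<Rightarrow> 'a fps" where
  "fprod s b m N = (\<Prod>k<N. 1 + fps_const s * fps_X ^ (b + m * k))"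

lemma fprod_0 [simp]: "fprod s b m 0 = 1"
  by (simp add: fprod_def)

lemma fprod_Suc: "fprod s b m (Suc N) = fprod s b m N * (1 + fps_const s * fps_X ^ (b + m * N))"
  by (simp add: fprod_def)

lemma fprod_double: "fprod s b m (2 * N) = fprod s b (2 * m) N * fprod s (b + m) (2 * m) N"
  by (induction N) (simp_all add: fprod_Suc algebra_simps)

lemma fprod_triple:
  "fprod s b m (3 * N) = fprod s b (3 * m) N * fprod s (b + m) (3 * m) N * fprod s (b + 2 * m) (3 * m) N"
proof (induction N)
  case (Suc N)
  have "3 * Suc N = Suc (Suc (Suc (3 * N)))" by simp
  then show ?case
    by (simp only: fprod_Suc Suc.IH) (simp add: algebra_simps)
qed simp

lemma fprod_mult_neg: "fprod (- 1) b m N * fprod 1 b m N = fprod (- 1 :: 'a::comm_ring_1) (2 * b) (2 * m) N"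
proof (induction N)
  case (Suc N)
  have "fprod (- 1) b m (Suc N) * fprod 1 b m (Suc N) =
    (fprod (- 1) b m N * fprod 1 b m N) * ((1 - fps_X ^ (b + m * N)) * (1 + fps_X ^ (b + m * N)))"
    by (simp add: fprod_Suc mult_ac flip: fps_const_neg)
  also have "(1 - fps_X ^ (b + m * N)) * (1 + fps_X ^ (b + m * N)) = 
     (1 + fps_const (-1) * (fps_X :: 'a fps) ^ (2 * b + 2 * m * N))"
    by (simp add: algebra_simps power_add power2_eq_square power_mult flip: fps_const_neg)
  finally show ?case by (simp only: Suc.IH fprod_Suc)
qed simp

lemma fprod_agree_1: "n \<le> b + m * k \<Longrightarrow> agree n (1 + fps_const s * fps_X ^ (b + m * k)) 1"
  by (auto simp: agree_def fps_X_power_nth)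

text \<open>A factor with index k >= M has exponent b + m k >= b + M >= n, so it is 1 modulo
  q^n.\<close>

lemma fprod_stable:
  assumes "m \<ge> 1" "n \<le> b + M" "M \<le> N"
  shows "agree n (fprod s b m N) (fprod s b m M)"
  using assms(3)
proof (induction N rule: dec_induct)
  case (step N)
  have "M \<le> m * N"
    using step.hyps assms(1) by (metis le_trans mult_le_mono1 nat_mult_1)
  hence "agree n (fprod s b m N * (1 + fps_const s * fps_X ^ (b + m * N))) (fprod s b m M * 1)"
    using assms by (intro agree_mult step.IH fprod_agree_1) auto
  thus ?case by (simp add: fprod_Suc)
qed simp

lemma Eq_agree_fprod:
  assumes "a \<ge> 1" "n \<le> a + N"
  shows "agree n (Eq a) (fprod (- 1) a a N)"
  unfolding agree_def
proof safe
  fix i assume "i < n"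
  have "fps_nth (Eq a) i = fps_nth (fprod (-1) a a i) i"
    by (simp add: Eq_def fprod_def prod.atLeast1_atMost_eq flip: fps_const_neg)
  also have "\<dots> = fps_nth (fprod (- 1) a a N) i"
  proof (cases "i \<le> N")
    case True
    have "agree (Suc i) (fprod (-1) a a N) (fprod (-1 :: rat) a a i)"
      by (rule fprod_stable) (use assms True in auto)
    thus ?thesis by (auto simp: agree_def)
  next
    case False
    have "agree (Suc i) (fprod (-1) a a i) (fprod (-1 :: rat) a a N)"
      by (rule fprod_stable) (use assms False \<open>i < n\<close> in auto)
    thus ?thesis by (auto simp: agree_def)
  qed
  finally show "fps_nth (Eq a) i = fps_nth (fprod (- 1) a a N) i" .
qed

lemma Eq_nth_0 [simp]: "fps_nth (Eq a) 0 = 1"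
  by (simp add: Eq_def)

lemma Eq_nonzero [simp]: "Eq a \<noteq> 0"
  using Eq_nth_0[of a] by (metis fps_zero_nth zero_neq_one)

subsection \<open>The Jacobi triple product\<close>

text \<open>Gaussian binomial coefficients, defined by the q-Pascal rule instead of a quotient so
  that p may be any ring element, such as the series a b.\<close>

fun qbinom :: "'a::comm_ring_1 \<Rightarrow> nat \<Rightarrow> nat \<Rightarrow> 'a" where
  "qbinom p n 0 = 1"
| "qbinom p 0 (Suc k) = 0"
| "qbinom p (Suc n) (Suc k) = qbinom p n k + p ^ Suc k * qbinom p n (Suc k)"

lemma qbinom_gt [simp]: "n < k \<Longrightarrow> qbinom p n k = 0"
  by (induction p n k rule: qbinom.induct) auto

lemma qbinom_same [simp]: "qbinom p n n = 1"
  by (induction n) auto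

text \<open>The companion q-Pascal rule. In the triple product this one adds a factor on the a side,
  the defining rule one on the b side.\<close>

lemma qbinom_Suc_Suc':
  "k \<le> n \<Longrightarrow> qbinom p (Suc n) (Suc k) = p ^ (n - k) * qbinom p n k + qbinom p n (Suc k)"
proof (induction n arbitrary: k)
  case (Suc n)
  show ?case
  proof (cases "k = Suc n")
    case False
    with Suc.prems have k: "k \<le> n" by simp
    have IH: "qbinom p (Suc n) (Suc k) = p ^ (n - k) * qbinom p n k + qbinom p n (Suc k)"
      using k by (rule Suc.IH)
    have pw: "p ^ Suc k * p ^ (n - k) = p ^ Suc n"
      using k by (simp only: power_add [symmetric]) simp
    show ?thesis
    proof (cases k)
      case 0
      then show ?thesis
        using IH pw by (simp add: algebra_simps)
    next
      case k': (Suc k')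
      have IH': "qbinom p (Suc n) (Suc k') = p ^ (n - k') * qbinom p n k' + qbinom p n (Suc k')"
        using k k' by (intro Suc.IH) auto
      have pw': "p ^ (Suc n - k) * p ^ k = p ^ Suc n"
        using k by (simp flip: power_add)
      have "qbinom p (Suc (Suc n)) (Suc k) = qbinom p (Suc n) k + p ^ Suc k * qbinom p (Suc n) (Suc k)"
        by simp
      also have "\<dots> = p ^ (Suc n - k) * qbinom p n k' + qbinom p n k +
          (p ^ Suc k * p ^ (n - k)) * qbinom p n k + p ^ Suc k * qbinom p n (Suc k)"
        unfolding IH unfolding k' IH' by (simp add: algebra_simps)
      also have "\<dots> = p ^ (Suc n - k) * (qbinom p n k' + p ^ k * qbinom p n k) +
          (qbinom p n k + p ^ Suc k * qbinom p n (Suc k))"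
        unfolding pw unfolding pw'[symmetric] by (simp only: algebra_simps)
      finally show ?thesis
        by (simp add: k')
    qed
  qed simp
qed auto

text \<open>Division-free form of the quotient formula. The Pascal step rests on (1 - p^k) + p^k (1
  - p^l) = 1 - p^(k+l).\<close>

lemma qbinom_mult_prods:
  "qbinom p (k + l) k * (\<Prod>i<k. 1 - p ^ Suc i) * (\<Prod>i<l. 1 - p ^ Suc i) = (\<Prod>i<k + l. 1 - p ^ Suc i)"
proof (induction "k + l" arbitrary: k l)
  case (Suc n)
  show ?case
  proof (cases k)
    case k: (Suc k')
    show ?thesis
    proof (cases l)
      case l: (Suc l')
      have 1: "qbinom p (k' + l) k' * (\<Prod>i<k'. 1 - p ^ Suc i) * (\<Prod>i<l. 1 - p ^ Suc i) =
          (\<Prod>i<k' + l. 1 - p ^ Suc i)"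
        using Suc.hyps k by auto
      have 2: "qbinom p (k' + l) k * (\<Prod>i<k. 1 - p ^ Suc i) * (\<Prod>i<l'. 1 - p ^ Suc i) =
          (\<Prod>i<k' + l. 1 - p ^ Suc i)"
        using Suc.hyps(1)[of k l'] Suc.hyps(2) k l by auto
      have "qbinom p (k + l) k = qbinom p (k' + l) k' + p ^ k * qbinom p (k' + l) k"
        by (simp add: k)
      hence "qbinom p (k + l) k * (\<Prod>i<k. 1 - p ^ Suc i) * (\<Prod>i<l. 1 - p ^ Suc i) =
        (qbinom p (k' + l) k' * (\<Prod>i<k'. 1 - p ^ Suc i) * (\<Prod>i<l. 1 - p ^ Suc i)) * (1 - p ^ k) +
        p ^ k * (1 - p ^ l) * (qbinom p (k' + l) k * (\<Prod>i<k. 1 - p ^ Suc i) * (\<Prod>i<l'. 1 - p ^ Suc i))"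
        by (simp add: k l algebra_simps)
      also have "\<dots> = (\<Prod>i<k' + l. 1 - p ^ Suc i) * (1 - p ^ (k + l))"
        unfolding 1 2 by (simp add: algebra_simps power_add)
      also have "\<dots> = (\<Prod>i<k + l. 1 - p ^ Suc i)"
        by (simp add: k)
      finally show ?thesis .
    qed simp
  qed simp
qed simp

section \<open>Theta terms and the finite triple product\<close>

definition tri :: "int \<Rightarrow> nat" where
  "tri j = nat (j * (j + 1) div 2)"

lemma two_tri: "2 * int (tri j) = j * (j + 1)"
proof -
  have "even (j * (j + 1))" by auto
  moreover have "j * (j + 1) \<ge> 0"
    by (cases "j \<ge> 0") (auto simp: zero_le_mult_iff)
  ultimately show ?thesis
    unfolding tri_def by (metis dvd_mult_div_cancel int_nat_eq pos_imp_zdiv_nonneg_iff zero_less_numeral)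
qed

text \<open>General term of Ramanujan's theta function f(a, b).\<close>

definition theta_term :: "'a::comm_ring_1 \<Rightarrow> 'a \<Rightarrow> int \<Rightarrow> 'a" where
  "theta_term a b j = a ^ tri j * b ^ tri (j - 1)"

text \<open>Passing from j to j + 1 multiplies the term by a (a b)^j. A factor a (a b)^n thus shifts
  the index and leaves (a b)^(n - j), the weight in the companion Pascal rule.\<close>

lemma theta_term_up:
  assumes "j \<le> int n"
  shows "a * (a * b) ^ n * theta_term a b j = (a * b) ^ nat (int n - j) * theta_term a b (j + 1)"
proof -
  have 1: "1 + n + tri j = nat (int n - j) + tri (j + 1)"
    using assms two_tri[of j] two_tri[of "j + 1"] by (simp add: algebra_simps)
  have 2: "n + tri (j - 1) = nat (int n - j) + tri j"
    using assms two_tri[of j] two_tri[of "j - 1"] by (simp add: algebra_simps)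
  have "a * (a * b) ^ n * theta_term a b j = a ^ (1 + n + tri j) * b ^ (n + tri (j - 1))"
    by (simp add: theta_term_def power_mult_distrib power_add mult_ac)
  also have "\<dots> = (a * b) ^ nat (int n - j) * theta_term a b (j + 1)"
    unfolding 1 2 by (simp add: theta_term_def power_mult_distrib power_add mult_ac)
  finally show ?thesis .
qed

lemma tri_minus: "tri (- j) = tri (j - 1)"
  using two_tri[of "-j"] two_tri[of "j - 1"] by (simp add: algebra_simps)

lemma theta_term_minus: "theta_term a b (- j) = theta_term b a j"
  using tri_minus[of j] tri_minus[of "j + 1"] by (simp add: theta_term_def mult.commute)

lemma theta_term_down:
  assumes "- j \<le> int n"
  shows "b * (a * b) ^ n * theta_term a b j = (a * b) ^ nat (int n + j) * theta_term a b (j - 1)"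
  using theta_term_up[OF assms, of b a] theta_term_minus[of b a j] theta_term_minus[of b a "j - 1"]
  by (simp add: mult.commute)

lemma theta_term_0 [simp]: "theta_term a b 0 = 1"
  by (simp add: theta_term_def tri_def)

text \<open>Induction on n with m = 0, then on m. A new a-factor is absorbed by
  \<open>theta_term_up\<close> and \<open>qbinom_Suc_Suc'\<close>, a new b-factor by
  \<open>theta_term_down\<close> and the defining Pascal rule.\<close>

theorem finite_jacobi_triple:
  fixes a b :: "'a::comm_ring_1"
  shows "(\<Prod>k<n. 1 + a * (a * b) ^ k) * (\<Prod>k<m. 1 + b * (a * b) ^ k) =
    (\<Sum>k\<le>n + m. qbinom (a * b) (n + m) k * theta_term a b (int k - int m))"
proof (induction m)
  case 0
  show ?case
  proof (induction n)
    case (Suc n)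
    have "(\<Sum>k\<le>Suc n. qbinom (a * b) (Suc n) k * theta_term a b (int k)) =
       1 + (\<Sum>k\<le>n. qbinom (a * b) (Suc n) (Suc k) * theta_term a b (int k + 1))"
      by (subst sum.atMost_Suc_shift) (simp add: add.commute)
    also have "(\<Sum>k\<le>n. qbinom (a * b) (Suc n) (Suc k) * theta_term a b (int k + 1)) =
       (\<Sum>k\<le>n. qbinom (a * b) n k * ((a * b) ^ nat (int n - int k) * theta_term a b (int k + 1))) +
       (\<Sum>k\<le>n. qbinom (a * b) n (Suc k) * theta_term a b (int (Suc k)))"
      unfolding sum.distrib[symmetric]
      by (intro sum.cong refl)
         (simp add: qbinom_Suc_Suc' nat_diff_distrib algebra_simps del: qbinom.simps)
    also have "(\<Sum>k\<le>n. qbinom (a * b) n k * ((a * b) ^ nat (int n - int k) * theta_term a b (int k + 1))) =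
       (\<Sum>k\<le>n. qbinom (a * b) n k * (a * (a * b) ^ n * theta_term a b (int k)))"
      by (intro sum.cong refl arg_cong2[of _ _ _ _ "(*)"] theta_term_up[symmetric]) auto
    also have "\<dots> = a * (a * b) ^ n * (\<Sum>k\<le>n. qbinom (a * b) n k * theta_term a b (int k))"
      by (simp add: sum_distrib_left mult_ac)
    also have "(\<Sum>k\<le>n. qbinom (a * b) n (Suc k) * theta_term a b (int (Suc k))) =
       (\<Sum>k\<le>n. qbinom (a * b) n k * theta_term a b (int k)) - 1"
      using sum.atMost_Suc_shift[of "\<lambda>k. qbinom (a * b) n k * theta_term a b (int k)" n]
      by simp
    finally show ?case
      using Suc.IH by (simp add: algebra_simps)
  qed simp
next
  case (Suc m)
  define N where "N = n + m"
  define Q where "Q = qbinom (a * b)"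
  define T where "T = (\<lambda>k. theta_term a b (int k - int m))"
  define T' where "T' = (\<lambda>k. theta_term a b (int k - int m - 1))"
  have "(\<Sum>k\<le>Suc N. Q (Suc N) k * T' k) =
       T' 0 + (\<Sum>k\<le>N. Q (Suc N) (Suc k) * T' (Suc k))"
    by (subst sum.atMost_Suc_shift) (simp add: Q_def)
  also have "(\<Sum>k\<le>N. Q (Suc N) (Suc k) * T' (Suc k)) =
       (\<Sum>k\<le>N. Q N k * T k) + (\<Sum>k\<le>N. Q N (Suc k) * ((a * b) ^ Suc k * T' (Suc k)))"
    unfolding sum.distrib[symmetric] Q_def T_def T'_def
    by (intro sum.cong refl) (simp add: algebra_simps)
  also have "(\<Sum>k\<le>N. Q N (Suc k) * ((a * b) ^ Suc k * T' (Suc k))) =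
       (\<Sum>k\<le>Suc N. Q N k * ((a * b) ^ k * T' k)) - T' 0"
    by (subst sum.atMost_Suc_shift) (simp add: Q_def)
  also have "(\<Sum>k\<le>Suc N. Q N k * ((a * b) ^ k * T' k)) = (\<Sum>k\<le>N. Q N k * ((a * b) ^ k * T' k))"
    by (simp add: Q_def)
  also have "(a * b) ^ k * T' k = b * (a * b) ^ m * T k" for k
    using theta_term_down[where a = a and b = b and n = m and j = "int k - int m"]
    by (simp add: T_def T'_def)
  hence "(\<Sum>k\<le>N. Q N k * ((a * b) ^ k * T' k)) = (\<Sum>k\<le>N. Q N k * (b * (a * b) ^ m * T k))"
    by simp
  also have "\<dots> = b * (a * b) ^ m * (\<Sum>k\<le>N. Q N k * T k)"
    by (simp add: sum_distrib_left mult_ac)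
  also have "T' 0 + ((\<Sum>k\<le>N. Q N k * T k) + (b * (a * b) ^ m * (\<Sum>k\<le>N. Q N k * T k) - T' 0)) =
     (\<Sum>k\<le>N. Q N k * T k) * (1 + b * (a * b) ^ m)"
    by (simp add: algebra_simps)
  also have "\<dots> = (\<Prod>k<n. 1 + a * (a * b) ^ k) * (\<Prod>k<m. 1 + b * (a * b) ^ k) * (1 + b * (a * b) ^ m)"
    unfolding Suc.IH by (simp add: N_def Q_def T_def)
  finally show ?case
    by (simp add: N_def Q_def T'_def algebra_simps)
qed

section \<open>Theta series and the infinite triple product\<close>

text \<open>For s = 1 or s = -1 this is f(s q^i, s q^j), because s^(k^2) = s^|k|. The exponent
  equation is doubled so that it is polynomial in k.\<close>

definition theta :: "rat \<Rightarrow> nat \<Rightarrow> nat \<Rightarrow> rat fps" where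
  "theta s i j = Abs_fps (\<lambda>N. \<Sum>k | int i * (k * (k + 1)) + int j * (k * (k - 1)) = 2 * int N. s ^ nat \<bar>k\<bar>)"

definition theta_exp :: "nat \<Rightarrow> nat \<Rightarrow> int \<Rightarrow> nat" where
  "theta_exp i j k = i * tri k + j * tri (k - 1)"

lemma theta_exp_eq_iff:
  "theta_exp i j k = N \<longleftrightarrow> int i * (k * (k + 1)) + int j * (k * (k - 1)) = 2 * int N"
proof -
  have "2 * int (theta_exp i j k) = int i * (k * (k + 1)) + int j * (k * (k - 1))"
  proof -
    have "2 * int (theta_exp i j k) = int i * (2 * int (tri k)) + int j * (2 * int (tri (k - 1)))"
      by (simp add: theta_exp_def)
    thus ?thesis
      unfolding two_tri by (simp add: mult.commute)
  qed
  thus ?thesis by linarith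
qed

text \<open>This amounts to k (k - 1) >= 0 for k >= 0 and to (k + 1) (k + 2) >= 0 for k < 0.\<close>

lemma tri_ge: "\<bar>k\<bar> \<le> int (tri k) + 1" "\<bar>k\<bar> \<le> int (tri (k - 1)) + 1"
proof -
  have *: "\<bar>k\<bar> \<le> int (tri k) + 1" for k
  proof (cases "k \<ge> 0")
    case True
    have "k * (k - 1) \<ge> 0"
      using True by (cases "k = 0") auto
    thus ?thesis using two_tri[of k] True by (simp add: algebra_simps)
  next
    case False
    have "(- k - 1) * (- k - 2) \<ge> 0"
      using False by (cases "k = - 1") (auto intro!: mult_nonneg_nonneg)
    thus ?thesis using two_tri[of k] False by (simp add: algebra_simps)
  qed
  show "\<bar>k\<bar> \<le> int (tri k) + 1" "\<bar>k\<bar> \<le> int (tri (k - 1)) + 1"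
    using *[of k] *[of "- k"] by (auto simp: tri_minus)
qed

text \<open>This bound makes every exponent fibre finite, and in the triple product it makes up for
  precision lost at the ends of the sum.\<close>

lemma theta_exp_ge:
  assumes "i + j \<ge> 1"
  shows "\<bar>k\<bar> \<le> int (theta_exp i j k) + 1"
proof (cases "i = 0")
  case True
  hence "tri (k - 1) \<le> theta_exp i j k"
    using assms by (simp add: theta_exp_def)
  thus ?thesis using tri_ge(2)[of k] by linarith
next
  case False
  hence "tri k \<le> theta_exp i j k"
    by (simp add: theta_exp_def trans_le_add1)
  thus ?thesis using tri_ge(1)[of k] by linarith
qed

lemma theta_nth: "fps_nth (theta s i j) N = (\<Sum>k | theta_exp i j k = N. s ^ nat \<bar>k\<bar>)"
  by (simp add: theta_def theta_exp_eq_iff)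

lemma finite_theta_fibre:
  assumes "i + j \<ge> 1"
  shows "finite {k. theta_exp i j k = N}"
proof (rule finite_subset)
  show "{k. theta_exp i j k = N} \<subseteq> {- (int N + 1)..int N + 1}"
  proof safe
    fix k
    show "k \<in> {- (int (theta_exp i j k) + 1)..int (theta_exp i j k) + 1}"
      using theta_exp_ge[OF assms, of k] by (simp add: abs_le_iff)
  qed
qed simp

lemma theta_term_monomial:
  assumes "s = 1 \<or> s = - 1"
  shows "theta_term (fps_const s * fps_X ^ i) (fps_const s * fps_X ^ j) k =
    fps_X ^ theta_exp i j k * fps_const (s ^ nat \<bar>k\<bar>)"
proof -
  have "int (tri k + tri (k - 1)) = int (nat \<bar>k\<bar> * nat \<bar>k\<bar>)"
    using two_tri[of k] two_tri[of "k - 1"] by (simp add: algebra_simps)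
  hence "tri k + tri (k - 1) = nat \<bar>k\<bar> * nat \<bar>k\<bar>" by linarith
  hence "s ^ (tri k + tri (k - 1)) = s ^ nat \<bar>k\<bar>"
    using assms by (auto simp: uminus_power_if)
  thus ?thesis
    by (simp add: theta_term_def theta_exp_def power_mult_distrib fps_const_power power_add
      flip: power_mult fps_const_mult) (simp add: mult_ac)
qed

text \<open>In the finite identity with n factors on both sides, multiplication by
  \<open>Eq m\<close> turns each Gaussian binomial into 1 modulo a power of q, and the bare theta
  terms remain.\<close>

theorem jacobi_triple_product:
  assumes m: "m = i + j" "m \<ge> 1" and s: "s = 1 \<or> s = - 1"
  shows "agree n (theta s i j) (Eq m * (fprod s i m n * fprod s j m n))"
proof -
  have ij: "i + j \<ge> 1" using m by simp
  define a b :: "rat fps" where "a = fps_const s * fps_X ^ i" and "b = fps_const s * fps_X ^ j"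
  have ab: "a * b = fps_X ^ m"
    using s by (auto simp: a_def b_def m power_add mult_ac)
  have fa: "fprod s i m n = (\<Prod>k<n. 1 + a * (a * b) ^ k)"
    unfolding ab by (simp add: fprod_def a_def power_add mult.assoc flip: power_mult)
  have fb: "fprod s j m n = (\<Prod>k<n. 1 + b * (a * b) ^ k)"
    unfolding ab by (simp add: fprod_def b_def power_add mult.assoc flip: power_mult)
  have E: "(\<Prod>k<N. 1 - (a * b) ^ Suc k) = fprod (- 1) m m N" for N
    unfolding ab by (simp add: fprod_def power_add power_mult flip: fps_const_neg)
  \<comment> \<open>The precision min(k, 2n - k) + 1 = n - |k - n| + 1 falls below n away from the
    middle of the sum.\<close>
  have Q: "agree (Suc (min k (n + n - k))) (Eq m * qbinom (a * b) (n + n) k) 1" if "k \<le> n + n" for k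
  proof -
    define q where "q = qbinom (a * b) (n + n) k"
    define d where "d = Suc (min k (n + n - k))"
    have "q * fprod (- 1) m m k * fprod (- 1) m m (n + n - k) = fprod (- 1) m m (n + n)"
      using qbinom_mult_prods[of "a * b" k "n + n - k", unfolded E] that by (simp add: q_def)
    moreover have "agree d (q * Eq m * Eq m) (q * fprod (- 1) m m k * fprod (- 1) m m (n + n - k))"
      using m by (intro agree_mult agree_refl Eq_agree_fprod) (auto simp: d_def)
    moreover have "agree d (fprod (- 1) m m (n + n)) (Eq m)"
      using m that by (intro agree_sym[OF Eq_agree_fprod]) (auto simp: d_def)
    ultimately have "agree d (Eq m * q * Eq m) (1 * Eq m)"
      by (metis agree_trans mult.commute mult_1)
    thus ?thesis
      unfolding d_def q_def by (rule agree_cancel) simp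
  qed
  have "agree n (Eq m * (fprod s i m n * fprod s j m n))
     (\<Sum>k\<le>n + n. theta_term a b (int k - int n))"
    unfolding fa fb finite_jacobi_triple sum_distrib_left
  proof (rule agree_sum)
    fix k assume k: "k \<in> {..n + n}"
    define e where "e = theta_exp i j (int k - int n)"
    define c where "c = fps_const (s ^ nat \<bar>int k - int n\<bar>)"
    have tt: "theta_term a b (int k - int n) = fps_X ^ e * c"
      unfolding a_def b_def e_def c_def by (rule theta_term_monomial) fact
    have "agree (e + Suc (min k (n + n - k)))
      (fps_X ^ e * (c * (Eq m * qbinom (a * b) (n + n) k))) (fps_X ^ e * (c * 1))"
      using k by (intro agree_X_power_mult agree_mult agree_refl Q) auto
    \<comment> \<open>The theta exponent is at least |k - n| - 1, which is exactly the loss.\<close>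
    moreover have "n \<le> e + Suc (min k (n + n - k))"
      using theta_exp_ge[OF ij, of "int k - int n"] k by (auto simp: e_def)
    ultimately have "agree n (fps_X ^ e * (c * (Eq m * qbinom (a * b) (n + n) k))) (fps_X ^ e * (c * 1))"
      by (rule agree_mono)
    thus "agree n (Eq m * (qbinom (a * b) (n + n) k * theta_term a b (int k - int n)))
            (theta_term a b (int k - int n))"
      unfolding tt by (simp add: mult_ac)
  qed
  also have "(\<Sum>k\<le>n + n. theta_term a b (int k - int n)) = (\<Sum>k\<in>{- int n..int n}. theta_term a b k)"
    by (rule sum.reindex_bij_witness[of _ "\<lambda>k. nat (k + int n)" "\<lambda>k. int k - int n"]) auto
  also have "agree n \<dots> (theta s i j)"
    unfolding agree_def
  proof safe
    fix N assume N: "N < n"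
    have "fps_nth (\<Sum>k\<in>{- int n..int n}. theta_term a b k) N =
      (\<Sum>k\<in>{- int n..int n}. if theta_exp i j k = N then s ^ nat \<bar>k\<bar> else 0)"
      unfolding a_def b_def theta_term_monomial[OF s] fps_sum_nth
      by (intro sum.cong refl) (auto simp: fps_X_power_mult_nth)
    also have "\<dots> = (\<Sum>k\<in>{k\<in>{- int n..int n}. theta_exp i j k = N}. s ^ nat \<bar>k\<bar>)"
      by (subst sum.inter_filter) auto
    also have "{k\<in>{- int n..int n}. theta_exp i j k = N} = {k. theta_exp i j k = N}"
    proof -
      have "k \<in> {- int n..int n}" if "theta_exp i j k = N" for k
        using theta_exp_ge[OF ij, of k] N that by (simp add: abs_le_iff)
      thus ?thesis by blast
    qed
    finally show "fps_nth (\<Sum>k\<in>{- int n..int n}. theta_term a b k) N = fps_nth (theta s i j) N"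
      by (simp add: theta_nth)
  qed
  finally show ?thesis
    by (rule agree_sym)
qed

section \<open>Product forms of four theta series\<close>

text \<open>The triple product contains the odd factors squared, and the odd factors times E(q^2)
  give E(q).\<close>

lemma theta_phi: "theta (- 1) 1 1 * Eq 2 = Eq 1 ^ 2"
proof (rule eq_if_agree)
  fix n
  have "agree n (theta (-1) 1 1 * Eq 2) (Eq 2 * (fprod (-1) 1 2 n * fprod (-1) 1 2 n) * Eq 2)"
    by (intro agree_mult agree_refl jacobi_triple_product) auto
  also have "\<dots> = (fprod (-1) 1 2 n * Eq 2) ^ 2"
    by (simp add: power2_eq_square mult_ac)
  also have "agree n \<dots> ((fprod (-1) 1 2 n * fprod (-1) 2 2 n) ^ 2)"
    by (intro agree_power agree_mult agree_refl Eq_agree_fprod) auto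
  also have "fprod (-1) 1 2 n * fprod (-1) 2 2 n = fprod (-1 :: rat) 1 1 (2 * n)"
    using fprod_double[of "-1 :: rat" 1 1 n] by (simp del: One_nat_def)
  also have "agree n (fprod (-1) 1 1 (2 * n) ^ 2) (Eq 1 ^ 2)"
    by (intro agree_power agree_sym[OF Eq_agree_fprod]) auto
  finally show "agree n (theta (-1) 1 1 * Eq 2) (Eq 1 ^ 2)" .
qed

lemma agree_Eq_mult_fprod:
  assumes "m \<ge> 1" "n \<le> m + N"
  shows "agree n (Eq m * fprod 1 m m N) (Eq (2 * m))"
proof -
  have "agree n (Eq m * fprod 1 m m N) (fprod (- 1) m m N * fprod 1 m m N)"
    by (intro agree_mult agree_refl Eq_agree_fprod assms)
  also have "\<dots> = fprod (- 1) (2 * m) (2 * m) N"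
    by (rule fprod_mult_neg)
  also have "agree n \<dots> (Eq (2 * m))"
    using assms by (intro agree_sym[OF Eq_agree_fprod]) auto
  finally show ?thesis .
qed

lemma theta_psi: "theta 1 0 1 * Eq 1 = 2 * Eq 2 ^ 2"
proof (rule eq_if_agree)
  fix n
  \<comment> \<open>The factor of index 0 is 1 + q^0 = 2; peeling it off is why \<open>Suc n\<close>
    factors are taken.\<close>
  have shift: "fprod (1::rat) 0 1 (Suc n) = 2 * fprod 1 1 1 n"
    unfolding fprod_def by (subst prod.lessThan_Suc_shift) simp
  have "agree (Suc n) (theta 1 0 1) (Eq 1 * (fprod 1 0 1 (Suc n) * fprod 1 1 1 (Suc n)))"
    by (rule jacobi_triple_product) auto
  hence "agree n (theta 1 0 1 * Eq 1) (Eq 1 * (fprod 1 0 1 (Suc n) * fprod 1 1 1 (Suc n)) * Eq 1)"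
    by (intro agree_mult agree_refl) (rule agree_mono, auto)
  also have "\<dots> = 2 * ((Eq 1 * fprod 1 1 1 n) * (Eq 1 * fprod 1 1 1 (Suc n)))"
    unfolding shift by (simp add: mult_ac)
  also have "agree n \<dots> (2 * (Eq (2 * 1) * Eq (2 * 1)))"
    by (intro agree_mult agree_refl agree_Eq_mult_fprod) auto
  finally show "agree n (theta 1 0 1 * Eq 1) (2 * Eq 2 ^ 2)"
    by (simp add: power2_eq_square)
qed

text \<open>The product carries the exponents 1 and 2 modulo 3; class 0 comes from E(q^6) = E(q^3)
  (-q^3; q^3).\<close>

lemma theta_1_2: "theta 1 1 2 * (Eq 1 * Eq 6) = Eq 2 * Eq 3 ^ 2"
proof (rule eq_if_agree)
  fix n
  have "agree n (theta 1 1 2 * (Eq 1 * Eq 6))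
          (Eq 3 * (fprod 1 1 3 n * fprod 1 2 3 n) * (Eq 1 * (Eq 3 * fprod 1 3 3 n)))"
    using agree_Eq_mult_fprod[of 3 n n]
    by (intro agree_mult agree_refl jacobi_triple_product) (auto intro: agree_sym)
  also have "\<dots> = Eq 3 ^ 2 * (Eq 1 * fprod 1 1 1 (3 * n))"
    using fprod_triple[of "1 :: rat" 1 1 n]
    by (simp add: power2_eq_square mult_ac del: One_nat_def)
  also have "agree n \<dots> (Eq 3 ^ 2 * Eq (2 * 1))"
    by (intro agree_mult agree_refl agree_Eq_mult_fprod) auto
  finally show "agree n (theta 1 1 2 * (Eq 1 * Eq 6)) (Eq 2 * Eq 3 ^ 2)"
    by (simp add: mult.commute)
qed

lemma agree_Eq_odd_factors:
  assumes "m \<ge> 1" "n \<le> m + N"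
  shows "agree n (Eq (2 * m) * fprod (- 1) m (2 * m) N) (Eq m)"
proof -
  have "agree n (Eq (2 * m) * fprod (- 1) m (2 * m) N)
      (fprod (- 1) (2 * m) (2 * m) N * fprod (- 1) m (2 * m) N)"
    using assms by (intro agree_mult agree_refl Eq_agree_fprod) auto
  also have "\<dots> = fprod (- 1) m m (2 * N)"
    by (subst fprod_double) (simp add: mult.commute flip: mult_2)
  also have "agree n \<dots> (Eq m)"
    using assms by (intro agree_sym[OF Eq_agree_fprod]) auto
  finally show ?thesis .
qed

text \<open>The classes 1 and 5 modulo 6 are completed to all odd exponents by class 3, taken from
  E(q^3) = E(q^6) (q^3; q^6).\<close>

lemma theta_1_5: "theta (- 1) 1 5 * (Eq 2 * Eq 3) = Eq 1 * Eq 6 ^ 2"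
proof (rule eq_if_agree)
  fix n
  have "agree n (theta (- 1) 1 5 * (Eq 2 * Eq 3))
          (Eq 6 * (fprod (- 1) 1 6 n * fprod (- 1) 5 6 n) * (Eq 2 * (Eq 6 * fprod (- 1) 3 6 n)))"
    using agree_Eq_odd_factors[of 3 n n]
    by (intro agree_mult agree_refl jacobi_triple_product) (auto intro: agree_sym)
  also have "\<dots> = Eq 6 ^ 2 * (Eq (2 * 1) * fprod (- 1) 1 (2 * 1) (3 * n))"
    using fprod_triple[of "- 1 :: rat" 1 2 n]
    by (simp add: power2_eq_square mult_ac del: One_nat_def)
  also have "agree n \<dots> (Eq 6 ^ 2 * Eq 1)"
    by (intro agree_mult agree_refl agree_Eq_odd_factors) auto
  finally show "agree n (theta (- 1) 1 5 * (Eq 2 * Eq 3)) (Eq 1 * Eq 6 ^ 2)"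
    by (simp add: mult.commute)
qed

subsection \<open>Cubic dissections\<close>

definition V :: "rat fps \<Rightarrow> rat fps" where "V f = f oo fps_X ^ 3"

text \<open>\<open>D 0\<close> is Atkin's operator U_3.\<close>

definition D :: "nat \<Rightarrow> rat fps \<Rightarrow> rat fps" where "D r f = Abs_fps (\<lambda>n. fps_nth f (3 * n + r))"

lemma D_nth [simp]: "fps_nth (D r f) n = fps_nth f (3 * n + r)"
  by (simp add: D_def)

lemma V_nth: "fps_nth (V f) n = (if 3 dvd n then fps_nth f (n div 3) else 0)"
  by (simp add: V_def fps_nth_compose_X_power)

lemma V_simps [simp]:
  "V (f + h) = V f + V h" "V (f - h) = V f - V h" "V (- f) = - V f"
  "V (f * h) = V f * V h" "V (f ^ n) = V f ^ n"
  "V 0 = 0" "V 1 = 1" "V (numeral k) = numeral k" "V fps_X = fps_X ^ 3"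
  "V (fps_const c) = fps_const c"
  by (simp_all add: V_def fps_compose_add_distrib fps_compose_sub_distrib fps_compose_uminus
      fps_compose_mult_distrib fps_compose_power)

lemma V_nth_0 [simp]: "fps_nth (V f) 0 = fps_nth f 0"
  by (simp add: V_nth)

lemma D_add [simp]: "D r (f + h) = D r f + D r h"
  by (simp add: fps_eq_iff)

lemma dissection_nth:
  "fps_nth (V a + fps_X * V b + fps_X ^ 2 * V c) (3 * n) = fps_nth a n"
  "fps_nth (V a + fps_X * V b + fps_X ^ 2 * V c) (3 * n + 1) = fps_nth b n"
  "fps_nth (V a + fps_X * V b + fps_X ^ 2 * V c) (3 * n + 2) = fps_nth c n"
proof -
  have "\<not> 3 dvd 3 * n - 1" "\<not> 3 dvd 3 * n - 2" if "n > 0"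
    using that by presburger+
  thus "fps_nth (V a + fps_X * V b + fps_X ^ 2 * V c) (3 * n) = fps_nth a n"
    by (cases "n = 0") (simp_all add: V_nth fps_X_power_mult_nth)
  have "\<not> 3 dvd Suc (3 * n)" "n > 0 \<Longrightarrow> \<not> 3 dvd 3 * n - 1"
    by presburger+
  thus "fps_nth (V a + fps_X * V b + fps_X ^ 2 * V c) (3 * n + 1) = fps_nth b n"
    by (cases "n = 0") (simp_all add: V_nth fps_X_power_mult_nth)
  have "\<not> 3 dvd Suc (3 * n)" "\<not> 3 dvd Suc (Suc (3 * n))"
    by presburger+
  thus "fps_nth (V a + fps_X * V b + fps_X ^ 2 * V c) (3 * n + 2) = fps_nth c n"
    by (simp add: V_nth fps_X_power_mult_nth)
qed

lemma dissection: "f = V (D 0 f) + fps_X * V (D 1 f) + fps_X ^ 2 * V (D 2 f)"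
proof (rule fps_ext)
  fix n :: nat
  define k where "k = n div 3"
  have "n = 3 * k \<or> n = 3 * k + 1 \<or> n = 3 * k + 2"
    unfolding k_def by linarith
  thus "fps_nth f n = fps_nth (V (D 0 f) + fps_X * V (D 1 f) + fps_X ^ 2 * V (D 2 f)) n"
    by (elim disjE) (simp_all only: dissection_nth D_nth add_0_right)
qed

lemma dissection_eqI:
  assumes "f = V a + fps_X * V b + fps_X ^ 2 * V c"
  shows "D 0 f = a" "D 1 f = b" "D 2 f = c"
  unfolding assms by (simp_all only: fps_eq_iff D_nth dissection_nth add_0_right simp_thms)

lemma D_V_mult:
  assumes "r \<le> 2"
  shows "D r (V a * f) = a * D r f"
proof -
  have "V a * f = V a * (V (D 0 f) + fps_X * V (D 1 f) + fps_X ^ 2 * V (D 2 f))"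
    using dissection[of f] by simp
  also have "\<dots> = V (a * D 0 f) + fps_X * V (a * D 1 f) + fps_X ^ 2 * V (a * D 2 f)"
    by (simp add: algebra_simps)
  finally have "V a * f = \<dots>" .
  from dissection_eqI[OF this] assms show ?thesis
    by (metis One_nat_def Suc_1 le_0_eq le_SucE)
qed

section \<open>The cubic norm and its value on E\<close>

text \<open>With \<open>\<zeta>\<close> a primitive cube root of unity, \<open>V (cubic_norm f)\<close> is \<open>f(q) f(\<zeta> q) f(\<zeta>\<^sup>2 q)\<close>.\<close>
definition cubic_norm :: "rat fps \<Rightarrow> rat fps" where
  "cubic_norm f = D 0 f ^ 3 + fps_X * D 1 f ^ 3 + fps_X ^ 2 * D 2 f ^ 3 - 3 * fps_X * D 0 f * D 1 f * D 2 f"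

text \<open>The defining expression is the norm form of series in q over series in q^3. Expanding
  the product of two dissections proves multiplicativity over the rationals.\<close>

lemma cubic_norm_mult: "cubic_norm (f * h) = cubic_norm f * cubic_norm h"
proof -
  define a b c a' b' c' where defs: "a = D 0 f" "b = D 1 f" "c = D 2 f"
    "a' = D 0 h" "b' = D 1 h" "c' = D 2 h"
  have "f * h = (V a + fps_X * V b + fps_X ^ 2 * V c) * (V a' + fps_X * V b' + fps_X ^ 2 * V c')"
    unfolding defs using dissection[of f] dissection[of h] by simp
  also have "\<dots> = V (a * a' + fps_X * (b * c' + c * b')) + fps_X * V (a * b' + b * a' + fps_X * (c * c')) +
     fps_X ^ 2 * V (a * c' + b * b' + c * a')"
    by (simp add: algebra_simps power2_eq_square power3_eq_cube)
  finally have "f * h = \<dots>" .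
  note * = dissection_eqI[OF this]
  show ?thesis
    unfolding cubic_norm_def * unfolding defs[symmetric]
    by (simp add: algebra_simps power2_eq_square power3_eq_cube)
qed

lemma cubic_norm_1 [simp]: "cubic_norm 1 = 1"
proof -
  have "1 = V 1 + fps_X * V 0 + fps_X ^ 2 * V 0" by simp
  note * = dissection_eqI[OF this]
  show ?thesis unfolding cubic_norm_def * by simp
qed

text \<open>The product of the three conjugates of 1 - q^k is 1 - q^(3k) if 3 does not divide k and
  (1 - q^k)^3 otherwise; then q^3 is read as q.\<close>

lemma cubic_norm_factor:
  "\<not> 3 dvd k \<Longrightarrow> cubic_norm (1 - fps_X ^ k) = 1 - fps_X ^ k"
  "cubic_norm (1 - fps_X ^ (3 * k)) = (1 - fps_X ^ k) ^ 3"
proof -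
  have "1 - fps_X ^ (3 * k) = V (1 - fps_X ^ k) + fps_X * V 0 + fps_X ^ 2 * V 0"
    by (simp add: power_mult)
  note * = dissection_eqI[OF this]
  show "cubic_norm (1 - fps_X ^ (3 * k)) = (1 - fps_X ^ k) ^ 3"
    unfolding cubic_norm_def * by simp
next
  assume k: "\<not> 3 dvd k"
  define l where "l = k div 3"
  have "k = 3 * l + 1 \<or> k = 3 * l + 2"
    using k unfolding l_def by presburger
  then consider "k = 3 * l + 1" | "k = 3 * l + 2"
    by blast
  thus "cubic_norm (1 - fps_X ^ k) = 1 - fps_X ^ k"
  proof cases
    case 1
    have "1 - fps_X ^ k = V 1 + fps_X * V (- (fps_X ^ l)) + fps_X ^ 2 * V 0"
      by (simp add: 1 power_add power_mult)
    note * = dissection_eqI[OF this]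
    have "(fps_X ^ l) ^ 3 = (fps_X :: rat fps) ^ (3 * l)"
      by (simp add: mult.commute flip: power_mult)
    then show ?thesis unfolding cubic_norm_def * by (simp add: 1)
  next
    case 2
    have "1 - fps_X ^ k = V 1 + fps_X * V 0 + fps_X ^ 2 * V (- (fps_X ^ l))"
      by (simp add: 2 power_add power_mult power2_eq_square)
    note * = dissection_eqI[OF this]
    have "(fps_X ^ l) ^ 3 = (fps_X :: rat fps) ^ (3 * l)"
      by (simp add: mult.commute flip: power_mult)
    then show ?thesis unfolding cubic_norm_def * by (simp add: 2 power2_eq_square)
  qed
qed

lemma agree_diff: "agree n f h \<Longrightarrow> agree n f' h' \<Longrightarrow> agree n (f - f') (h - h')"
  by (simp add: agree_def)

text \<open>Precision drops by a factor 3 because coefficient i of \<open>D r f\<close> is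
  coefficient 3 i + r of f.\<close>

lemma agree_cubic_norm:
  assumes "agree (3 * n) f h"
  shows "agree n (cubic_norm f) (cubic_norm h)"
proof -
  have "agree n (D r f) (D r h)" if "r \<le> 2" for r
    using assms that by (auto simp: agree_def)
  thus ?thesis
    unfolding cubic_norm_def
    by (intro agree_diff agree_add agree_mult agree_power agree_refl) auto
qed

text \<open>The norm fixes the factors 1 - q^(a j) with 3 not dividing j; those with 3 | j become
  cubes, and the second product on the left restores them.\<close>

lemma cubic_norm_fprod:
  assumes "\<not> 3 dvd a"
  shows "cubic_norm (fprod (- 1) a a (3 * N)) * fprod (- 1) (3 * a) (3 * a) N =
    fprod (- 1) a a (3 * N) * fprod (- 1) a a N ^ 3"
proof (induction N)
  case (Suc N)
  let ?u = "1 - fps_X ^ (a * (3 * N + 1)) :: rat fps" and ?v = "1 - fps_X ^ (a * (3 * N + 2)) :: rat fps"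
  let ?w = "1 - fps_X ^ (3 * (a * (N + 1))) :: rat fps" and ?z = "1 - fps_X ^ (a * (N + 1)) :: rat fps"
  have 3: "3 * Suc N = Suc (Suc (Suc (3 * N)))" by simp
  have F: "fprod (- 1) a a (3 * Suc N) = fprod (- 1) a a (3 * N) * ?u * ?v * ?w"
    unfolding 3 fprod_Suc by (simp add: algebra_simps flip: fps_const_neg)
  have F': "fprod (- 1) (3 * a) (3 * a) (Suc N) = fprod (- 1) (3 * a) (3 * a) N * ?w"
    "fprod (- 1) a a (Suc N) = fprod (- 1) a a N * ?z"
    unfolding fprod_Suc by (simp_all add: algebra_simps flip: fps_const_neg)
  have "prime (3::nat)" by simp
  hence nd: "\<not> 3 dvd a * (3 * N + 1)" "\<not> 3 dvd a * (3 * N + 2)"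
    using assms by (simp_all only: prime_dvd_mult_iff de_Morgan_disj) presburger+
  have "cubic_norm (fprod (- 1) a a (3 * Suc N)) * fprod (- 1) (3 * a) (3 * a) (Suc N) =
    (cubic_norm (fprod (- 1) a a (3 * N)) * fprod (- 1) (3 * a) (3 * a) N) * ?u * ?v * ?z ^ 3 * ?w"
    unfolding F F' cubic_norm_mult cubic_norm_factor(1)[OF nd(1)] cubic_norm_factor(1)[OF nd(2)]
      cubic_norm_factor(2) by (simp only: mult_ac)
  also have "\<dots> = fprod (- 1) a a (3 * Suc N) * fprod (- 1) a a (Suc N) ^ 3"
    unfolding Suc.IH F F' by (simp only: mult_ac power_mult_distrib)
  finally show ?case .
qed simp

lemma cubic_norm_Eq:
  assumes "\<not> 3 dvd a"
  shows "cubic_norm (Eq a) * Eq (3 * a) = Eq a ^ 4"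
proof (rule eq_if_agree)
  fix n
  have a: "a \<ge> 1" using assms by (cases a) auto
  have "agree n (cubic_norm (Eq a) * Eq (3 * a))
      (cubic_norm (fprod (- 1) a a (3 * n)) * fprod (- 1) (3 * a) (3 * a) n)"
    using a by (intro agree_mult agree_cubic_norm Eq_agree_fprod) auto
  also have "\<dots> = fprod (- 1) a a (3 * n) * fprod (- 1) a a n ^ 3"
    using assms by (rule cubic_norm_fprod)
  also have "agree n \<dots> (Eq a * Eq a ^ 3)"
    using a by (intro agree_mult agree_power agree_sym[OF Eq_agree_fprod]) auto
  also have "\<dots> = Eq a ^ 4"
    by (simp add: eval_nat_numeral)
  finally show "agree n (cubic_norm (Eq a) * Eq (3 * a)) (Eq a ^ 4)" .
qed

lemma V_fprod: "V (fprod s b m N) = fprod s (3 * b) (3 * m) N"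
  by (induction N) (simp_all add: fprod_Suc power_mult power_add flip: power_mult)

lemma agree_V: "agree n f h \<Longrightarrow> agree n (V f) (V h)"
  by (auto simp: agree_def V_nth)

lemma V_Eq:
  assumes "a \<ge> 1"
  shows "V (Eq a) = Eq (3 * a)"
proof (rule eq_if_agree)
  fix n
  have "agree n (V (Eq a)) (V (fprod (- 1) a a n))"
    using assms by (intro agree_V Eq_agree_fprod) auto
  also have "\<dots> = fprod (- 1) (3 * a) (3 * a) n"
    by (rule V_fprod)
  also have "agree n \<dots> (Eq (3 * a))"
    using assms by (intro agree_sym[OF Eq_agree_fprod]) auto
  finally show "agree n (V (Eq a)) (Eq (3 * a))" .
qed

section \<open>3-dissections of the two theta series\<close>

lemma theta_nth': "fps_nth (theta s i j) N =
   (\<Sum>k | int i * (k * (k + 1)) + int j * (k * (k - 1)) = 2 * int N. s ^ nat \<bar>k\<bar>)"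
  by (simp add: theta_def)

text \<open>Split the squares k^2 by k modulo 3. Multiples of 3 reproduce the series in q^9; k and
  -k exchange classes 1 and 2, where (3l - 1)^2 = 3 (3l^2 - 2l) + 1 carries the sign -(-1)^l. No
  square is 2 modulo 3.\<close>

lemma theta_phi_dissection:
  "theta (- 1) 1 1 = V (V (theta (- 1) 1 1)) - 2 * fps_X * V (theta (- 1) 1 5)"
proof -
  have sq: "fps_nth (theta (- 1) 1 1) N = (\<Sum>k | k * k = int N. (- 1) ^ nat \<bar>k\<bar>)" for N
    unfolding theta_nth' by (intro sum.cong) (auto simp: algebra_simps)
  have om: "fps_nth (theta (- 1) 1 5) N = (\<Sum>k | 3 * (k * k) - 2 * k = int N. (- 1) ^ nat \<bar>k\<bar>)" for N
    unfolding theta_nth' by (intro sum.cong) (auto simp: algebra_simps)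
  have D0: "D 0 (theta (- 1) 1 1) = V (theta (- 1) 1 1)"
  proof (rule fps_ext)
    fix N
    have mod3: "3 dvd k" if "k * k = 3 * int N" for k :: int
    proof -
      have "3 dvd k * k" using that by simp
      moreover have "prime (3::int)" by simp
      ultimately show ?thesis by (simp add: prime_dvd_mult_iff)
    qed
    show "fps_nth (D 0 (theta (- 1) 1 1)) N = fps_nth (V (theta (- 1) 1 1)) N"
    proof (cases "3 dvd N")
      case True
      then obtain M where M: "N = 3 * M" by auto
      have "(\<Sum>k | k * k = 3 * int N. (- 1 :: rat) ^ nat \<bar>k\<bar>) = (\<Sum>k | k * k = int M. (- 1) ^ nat \<bar>k\<bar>)"
      proof (rule sum.reindex_bij_witness[of _ "\<lambda>k. 3 * k" "\<lambda>k. k div 3"])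
        fix k :: int assume "k \<in> {k. k * k = 3 * int N}"
        hence kk: "k * k = 3 * int N" by simp
        with mod3 obtain l where l: "k = 3 * l" by (meson dvdE)
        show "3 * (k div 3) = k" "k div 3 \<in> {k. k * k = int M}"
          using l kk by (simp_all add: M)
        show "(- 1 :: rat) ^ nat \<bar>k div 3\<bar> = (- 1) ^ nat \<bar>k\<bar>"
          using l by (simp add: uminus_power_if even_nat_iff)
      qed (auto simp: M)
      thus ?thesis by (simp add: sq V_nth M del: One_nat_def)
    next
      case False
      have "{k. k * k = 3 * int N} = {}"
      proof safe
        fix k :: int assume "k * k = 3 * int N"
        moreover obtain l where "k = 3 * l" using mod3[OF calculation] by auto
        ultimately have "int N = 3 * (l * l)" by simp
        hence "3 dvd int N" by simp
        thus "k \<in> {}" using False by presburger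
      qed
      hence "(\<Sum>k | k * k = 3 * int N. (- 1 :: rat) ^ nat \<bar>k\<bar>) = 0" by (simp only: sum.empty)
      thus ?thesis using False by (simp add: sq V_nth del: One_nat_def)
    qed
  qed
  have D1: "D 1 (theta (- 1) 1 1) = - 2 * theta (- 1) 1 5"
  proof (rule fps_ext)
    fix N
    let ?S = "{k. k * k = 3 * int N + 1}"
    have fin: "finite ?S"
    proof (rule finite_subset)
      show "?S \<subseteq> {k. theta_exp 1 1 k = 3 * N + 1}"
        by (auto simp: theta_exp_eq_iff algebra_simps)
    qed (rule finite_theta_fibre, simp)
    have "k mod 3 = 1 \<or> k mod 3 = 2" if "k \<in> ?S" for k
    proof -
      have "k * k mod 3 = 1" using that by simp
      hence "(k mod 3) * (k mod 3) mod 3 = 1" by (simp add: mod_mult_eq)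
      moreover have "k mod 3 = 0 \<or> k mod 3 = 1 \<or> k mod 3 = 2" by presburger
      ultimately show ?thesis by auto
    qed
    hence S: "?S = {k\<in>?S. k mod 3 = 1} \<union> {k\<in>?S. k mod 3 = 2}" by blast
    have part: "(\<Sum>k\<in>{k\<in>?S. k mod 3 = 2}. (- 1 :: rat) ^ nat \<bar>k\<bar>) =
        - (\<Sum>k | 3 * (k * k) - 2 * k = int N. (- 1) ^ nat \<bar>k\<bar>)"
      unfolding sum_negf[symmetric]
    proof (rule sum.reindex_bij_witness[of _ "\<lambda>k. 3 * k - 1" "\<lambda>k. (k + 1) div 3"])
      fix k :: int assume k: "k \<in> {k\<in>?S. k mod 3 = 2}"
      define l where "l = (k + 1) div 3"
      have l: "k = 3 * l - 1" using k unfolding l_def by auto presburger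
      show "3 * ((k + 1) div 3) - 1 = k" using l unfolding l_def by simp
      show "(k + 1) div 3 \<in> {k. 3 * (k * k) - 2 * k = int N}"
        using k unfolding l by (simp add: algebra_simps)
      show "- ((- 1 :: rat) ^ nat \<bar>(k + 1) div 3\<bar>) = (- 1) ^ nat \<bar>k\<bar>"
        unfolding l by (simp add: uminus_power_if even_nat_iff)
    next
      fix k :: int assume k: "k \<in> {k. 3 * (k * k) - 2 * k = int N}"
      show "3 * k - 1 \<in> {k\<in>?S. k mod 3 = 2}"
        using k by (auto simp: algebra_simps) presburger
    qed simp
    have part': "(\<Sum>k\<in>{k\<in>?S. k mod 3 = 1}. (- 1 :: rat) ^ nat \<bar>k\<bar>) =
        (\<Sum>k\<in>{k\<in>?S. k mod 3 = 2}. (- 1 :: rat) ^ nat \<bar>k\<bar>)"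
      by (rule sum.reindex_bij_witness[of _ uminus uminus]) (auto, presburger+)
    have "(\<Sum>k\<in>?S. (- 1 :: rat) ^ nat \<bar>k\<bar>) =
       (\<Sum>k\<in>{k\<in>?S. k mod 3 = 1}. (- 1 :: rat) ^ nat \<bar>k\<bar>) +
       (\<Sum>k\<in>{k\<in>?S. k mod 3 = 2}. (- 1 :: rat) ^ nat \<bar>k\<bar>)"
      using fin by (subst S, subst sum.union_disjoint) auto
    also have "\<dots> = - 2 * (\<Sum>k | 3 * (k * k) - 2 * k = int N. (- 1) ^ nat \<bar>k\<bar>)"
      unfolding part' part by simp
    finally show "fps_nth (D 1 (theta (- 1) 1 1)) N = fps_nth (- 2 * theta (- 1) 1 5) N"
      by (simp add: sq om algebra_simps numeral_fps_const del: One_nat_def)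
  qed
  have D2: "D 2 (theta (- 1) 1 1) = 0"
  proof (rule fps_ext)
    fix N
    have "{k. k * k = int (3 * N + 2)} = {}"
    proof safe
      fix k :: int assume "k * k = int (3 * N + 2)"
      hence "k * k mod 3 = 2" by simp
      hence "(k mod 3) * (k mod 3) mod 3 = 2" by (simp add: mod_mult_eq)
      moreover have "k mod 3 = 0 \<or> k mod 3 = 1 \<or> k mod 3 = 2" by presburger
      ultimately show "k \<in> {}" by auto
    qed
    thus "fps_nth (D 2 (theta (- 1) 1 1)) N = fps_nth 0 N"
      by (simp only: D_nth sq sum.empty fps_zero_nth)
  qed
  show ?thesis
    using dissection[of "theta (- 1) 1 1"] unfolding D0 D1 D2 by (simp add: algebra_simps)
qed

text \<open>Here k = 3l and k = 1 - 3l share the exponent 3 (3l^2 - l)/2, whence the factor 2, while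
  k = 3l - 1 gives 9 l (l - 1)/2 + 1.\<close>

lemma theta_psi_dissection:
  "theta 1 0 1 = 2 * V (theta 1 1 2) + fps_X * V (V (theta 1 0 1))"
proof -
  have ps: "fps_nth (theta 1 0 1) N = (\<Sum>k | k * (k - 1) = 2 * int N. 1)" for N
    by (simp add: theta_nth')
  have om: "fps_nth (theta 1 1 2) N = (\<Sum>k | 3 * (k * k) - k = 2 * int N. 1)" for N
    unfolding theta_nth' by (intro sum.cong) (auto simp: algebra_simps)
  \<comment> \<open>This concerns twice the exponent, so residue 2 means exponent 1 modulo
    3.\<close>
  have mod3: "k * (k - 1) mod 3 = (if k mod 3 = 2 then 2 else 0)" for k :: int
  proof -
    define l where "l = k div 3"
    have "k = 3 * l \<or> k = 3 * l + 1 \<or> k = 3 * l + 2"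
      unfolding l_def by presburger
    thus ?thesis
    proof (elim disjE)
      assume k: "k = 3 * l + 2"
      have "k * (k - 1) = 3 * (3 * (l * l) + 3 * l) + 2" by (simp add: k algebra_simps)
      moreover have "(3 * x + 2) mod 3 = 2" for x :: int by presburger
      ultimately have "k * (k - 1) mod 3 = 2" by (simp only:)
      moreover have "k mod 3 = 2" using k by presburger
      ultimately show ?thesis by simp
    next
      assume k: "k = 3 * l + 1"
      have "k * (k - 1) = 3 * (3 * (l * l) + l)" by (simp add: k algebra_simps)
      moreover have "k mod 3 = 1" using k by presburger
      ultimately show ?thesis by simp
    qed simp
  qed
  have D0: "D 0 (theta 1 0 1) = 2 * theta 1 1 2"
  proof (rule fps_ext)
    fix N
    let ?S = "{k. k * (k - 1) = 6 * int N}"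
    have fin: "finite ?S"
      using finite_theta_fibre[of 0 1 "3 * N"] by (simp add: theta_exp_eq_iff)
    have "k mod 3 = 0 \<or> k mod 3 = 1" if "k \<in> ?S" for k
    proof -
      have "k * (k - 1) mod 3 = 0" using that by simp
      with mod3[of k] have "k mod 3 \<noteq> 2" by auto
      thus ?thesis by presburger
    qed
    hence S: "?S = {k\<in>?S. k mod 3 = 0} \<union> {k\<in>?S. k mod 3 = 1}" by blast
    have part: "(\<Sum>k\<in>{k\<in>?S. k mod 3 = 0}. 1 :: rat) = (\<Sum>k | 3 * (k * k) - k = 2 * int N. 1)"
    proof (rule sum.reindex_bij_witness[of _ "\<lambda>k. 3 * k" "\<lambda>k. k div 3"])
      fix k :: int assume k: "k \<in> {k\<in>?S. k mod 3 = 0}"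
      then obtain l where l: "k = 3 * l" by auto
      show "3 * (k div 3) = k" using l by simp
      show "k div 3 \<in> {k. 3 * (k * k) - k = 2 * int N}"
        using k unfolding l by (simp add: algebra_simps)
    qed (auto simp: algebra_simps)
    have part': "(\<Sum>k\<in>{k\<in>?S. k mod 3 = 1}. 1 :: rat) = (\<Sum>k\<in>{k\<in>?S. k mod 3 = 0}. 1)"
      by (rule sum.reindex_bij_witness[of _ "\<lambda>k. 1 - k" "\<lambda>k. 1 - k"])
         (auto simp: algebra_simps, presburger+)
    have "(\<Sum>k\<in>?S. 1 :: rat) =
       (\<Sum>k\<in>{k\<in>?S. k mod 3 = 0}. 1) + (\<Sum>k\<in>{k\<in>?S. k mod 3 = 1}. 1)"
      using fin by (subst S, subst sum.union_disjoint) auto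
    also have "\<dots> = 2 * (\<Sum>k | 3 * (k * k) - k = 2 * int N. 1)"
      unfolding part' part by simp
    finally show "fps_nth (D 0 (theta 1 0 1)) N = fps_nth (2 * theta 1 1 2) N"
      by (simp add: ps om numeral_fps_const del: One_nat_def)
  qed
  have D1: "D 1 (theta 1 0 1) = V (theta 1 0 1)"
  proof (rule fps_ext)
    fix N
    let ?S = "{k. k * (k - 1) = 6 * int N + 2}"
    have S: "\<exists>l. k = 3 * l - 1 \<and> 3 * (l * (l - 1)) = 2 * int N" if "k \<in> ?S" for k
    proof -
      have "k * (k - 1) = 3 * (2 * int N) + 2" using that by simp
      hence "k * (k - 1) mod 3 = 2" by presburger
      with mod3[of k] have "k mod 3 = 2" by (auto split: if_splits)
      hence "k = 3 * ((k + 1) div 3) - 1" by presburger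
      then obtain l where l: "k = 3 * l - 1" by blast
      with that show ?thesis by (intro exI[of _ l]) (simp add: algebra_simps)
    qed
    show "fps_nth (D 1 (theta 1 0 1)) N = fps_nth (V (theta 1 0 1)) N"
    proof (cases "3 dvd N")
      case True
      then obtain M where M: "N = 3 * M" by auto
      have "(\<Sum>k\<in>?S. 1 :: rat) = (\<Sum>k | k * (k - 1) = 2 * int M. 1)"
      proof (rule sum.reindex_bij_witness[of _ "\<lambda>k. 3 * k - 1" "\<lambda>k. (k + 1) div 3"])
        fix k assume "k \<in> ?S"
        from S[OF this] obtain l where l: "k = 3 * l - 1" "3 * (l * (l - 1)) = 2 * int N"
          by blast
        show "3 * ((k + 1) div 3) - 1 = k" "(k + 1) div 3 \<in> {k. k * (k - 1) = 2 * int M}"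
          using l by (simp_all add: M)
      qed (auto simp: M algebra_simps)
      thus ?thesis by (simp add: ps V_nth M algebra_simps del: One_nat_def)
    next
      case False
      have "?S = {}"
      proof safe
        fix k assume "k * (k - 1) = 6 * int N + 2"
        hence "k \<in> ?S" by simp
        from S[OF this] obtain l where "3 * (l * (l - 1)) = 2 * int N" by blast
        hence "3 dvd N" by presburger
        thus "k \<in> {}" using False by simp
      qed
      hence "(\<Sum>k\<in>?S. 1 :: rat) = 0" by (simp only: sum.empty)
      thus ?thesis using False by (simp add: ps V_nth algebra_simps del: One_nat_def)
    qed
  qed
  have D2: "D 2 (theta 1 0 1) = 0"
  proof (rule fps_ext)
    fix N
    have "{k. k * (k - 1) = 2 * int (3 * N + 2)} = {}"
    proof safe
      fix k :: int assume "k * (k - 1) = 2 * int (3 * N + 2)"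
      hence "k * (k - 1) mod 3 = 1" by simp presburger
      with mod3[of k] show "k \<in> {}" by (auto split: if_splits)
    qed
    thus "fps_nth (D 2 (theta 1 0 1)) N = fps_nth 0 N"
      by (simp only: D_nth ps sum.empty fps_zero_nth)
  qed
  show ?thesis
    using dissection[of "theta 1 0 1"] unfolding D0 D1 D2 by (simp add: algebra_simps)
qed

subsection \<open>The modular equation and the two extraction operators\<close>

definition phi :: "rat fps" where "phi = theta (- 1) 1 1"
definition omega :: "rat fps" where "omega = theta (- 1) 1 5"
definition psi :: "rat fps" where "psi = Eq 2 ^ 2 * inverse (Eq 1)"
text \<open>\<open>t\<close> has only exponents that are 1 modulo 3; \<open>tau\<close> is its
  dissection component, so that t^3 = V (fps_X * tau^3).\<close>

definition tau :: "rat fps" where "tau = 2 * omega * inverse (V phi)"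
definition t :: "rat fps" where "t = fps_X * V tau"
definition y :: "rat fps" where "y = V phi ^ 4 * inverse phi ^ 4"

lemma phi_Eq: "phi * Eq 2 = Eq 1 ^ 2"
  unfolding phi_def by (rule theta_phi)

lemma omega_Eq: "omega * (Eq 2 * Eq 3) = Eq 1 * Eq 6 ^ 2"
  unfolding omega_def by (rule theta_1_5)

lemma psi_Eq: "psi * Eq 1 = Eq 2 ^ 2"
  by (simp add: psi_def mult.assoc inverse_mult_eq_1)

lemma nth_0_if_unit_mult:
  fixes f h k :: "'a::field fps"
  assumes "f * h = k" "fps_nth h 0 = 1" "fps_nth k 0 = 1"
  shows "fps_nth f 0 = 1"
  using assms by (metis fps_mult_nth_0 mult.right_neutral)

lemma phi_nth_0 [simp]: "fps_nth phi 0 = 1"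
  by (rule nth_0_if_unit_mult[OF phi_Eq]) (simp_all add: fps_power_zeroth)

lemma omega_nth_0 [simp]: "fps_nth omega 0 = 1"
  by (rule nth_0_if_unit_mult[OF omega_Eq]) (simp_all add: fps_power_zeroth)

lemma phi_nonzero [simp]: "phi \<noteq> 0" "V phi \<noteq> 0" "V (V phi) \<noteq> 0"
  by (metis V_nth_0 phi_nth_0 fps_zero_nth zero_neq_one)+

lemma phi_dissection: "phi = V (V phi) - 2 * fps_X * V omega"
  unfolding phi_def omega_def by (rule theta_phi_dissection)

text \<open>The norm of \<open>phi\<close> is computed twice: from its dissection, and by
  multiplicativity from \<open>phi_Eq\<close> and \<open>cubic_norm_Eq\<close>.\<close>

lemma cubic_norm_phi: "(V phi ^ 3 - 8 * fps_X * omega ^ 3) * V phi = phi ^ 4"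
proof -
  have "phi = V (V phi) + fps_X * V (- 2 * omega) + fps_X ^ 2 * V 0"
    using phi_dissection by (simp add: algebra_simps)
  note * = dissection_eqI[OF this]
  have N: "cubic_norm phi = V phi ^ 3 - 8 * fps_X * omega ^ 3"
    unfolding cubic_norm_def * by (simp add: power_mult_distrib)
  define n where "n = cubic_norm phi"
  define n1 where "n1 = cubic_norm (Eq 1)"
  define n2 where "n2 = cubic_norm (Eq 2)"
  have 1: "n * n2 = n1 ^ 2"
    unfolding n_def n1_def n2_def cubic_norm_mult[symmetric] phi_Eq
    by (simp add: power2_eq_square cubic_norm_mult)
  have 2: "n1 * Eq 3 = Eq 1 ^ 4" "n2 * Eq 6 = Eq 2 ^ 4"
    using cubic_norm_Eq[of 1] cubic_norm_Eq[of 2] by (simp_all add: n1_def n2_def)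
  have 3: "V phi * Eq 6 = Eq 3 ^ 2"
    using arg_cong[OF phi_Eq, of V] by (simp add: V_Eq)
  have "n * V phi * (Eq 6 ^ 2 * n2) = n1 ^ 2 * Eq 3 ^ 2 * Eq 6"
    using 1 3 by algebra
  also have "\<dots> = Eq 1 ^ 8 * Eq 6"
    using 2 by algebra
  also have "\<dots> = phi ^ 4 * Eq 2 ^ 4 * Eq 6"
    using phi_Eq by algebra
  also have "\<dots> = phi ^ 4 * (Eq 6 ^ 2 * n2)"
    using 2 by algebra
  finally have *: "n * V phi * (Eq 6 ^ 2 * n2) = phi ^ 4 * (Eq 6 ^ 2 * n2)" .
  have "n2 \<noteq> 0" using 2(2) by auto
  with * have "n * V phi = phi ^ 4" by simp
  thus ?thesis by (simp only: n_def N)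
qed

lemma tau_V_phi: "tau * V phi = 2 * omega"
  by (simp add: tau_def mult.assoc inverse_mult_eq_1)

lemma phi_eq_t: "phi = V (V phi) * (1 - t)"
proof -
  have "V (V phi) * t = fps_X * V (tau * V phi)"
    by (simp add: t_def mult_ac)
  also have "\<dots> = 2 * fps_X * V omega"
    unfolding tau_V_phi by (simp add: mult_ac)
  finally show ?thesis
    using phi_dissection by (simp add: algebra_simps)
qed

lemma y_phi: "y * phi ^ 4 = V phi ^ 4"
  by (simp add: y_def mult.assoc inverse_mult_eq_1 flip: power_mult_distrib)

lemma y_tau: "y * (1 - fps_X * tau ^ 3) = 1"
proof -
  have "y * (1 - fps_X * tau ^ 3) * V phi ^ 4 = y * ((V phi ^ 3 - fps_X * (tau * V phi) ^ 3) * V phi)"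
    by (simp add: algebra_simps eval_nat_numeral)
  also have "\<dots> = y * phi ^ 4"
    unfolding tau_V_phi using cubic_norm_phi by (simp add: power_mult_distrib mult_ac)
  also have "\<dots> = 1 * V phi ^ 4"
    by (simp add: y_phi)
  finally show ?thesis by simp
qed

lemma V_T: "V (fps_X * tau ^ 3) = t ^ 3"
  by (simp add: t_def power_mult_distrib)

lemma Vy_t: "V y * (1 - t ^ 3) = 1"
  using arg_cong[OF y_tau, of V] by (simp add: t_def power_mult_distrib)

text \<open>The fourth power of \<open>phi_eq_t\<close>. It makes 1 / y a quartic in t over series
  in q^3.\<close>

lemma y_inverse: "y * (V y * (1 - t) ^ 4) = 1"
proof -
  have z: "V y * V phi ^ 4 = V (V phi) ^ 4"
    using arg_cong[OF y_phi, of V] by simp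
  have "y * (V y * (1 - t) ^ 4) * V phi ^ 4 = y * (V (V phi) * (1 - t)) ^ 4"
    using z by (simp add: power_mult_distrib mult_ac)
  also have "\<dots> = 1 * V phi ^ 4"
    unfolding phi_eq_t[symmetric] by (simp add: y_phi)
  finally show ?thesis by simp
qed

lemma y_eq: "y = V y ^ 3 * (1 + t + t ^ 2) ^ 4"
proof -
  have f: "1 - t ^ 3 = (1 - t) * (1 + t + t ^ 2)"
    by (simp add: algebra_simps eval_nat_numeral)
  have "y = y * (V y * (1 - t ^ 3)) ^ 4"
    by (simp add: Vy_t)
  also have "\<dots> = y * (V y * (1 - t) ^ 4) * (V y ^ 3 * (1 + t + t ^ 2) ^ 4)"
    unfolding f power_mult_distrib by (simp add: eval_nat_numeral mult_ac)
  finally show ?thesis by (simp add: y_inverse)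
qed

section \<open>The cubic equation for y\<close>

definition c2 :: "'a::comm_ring_1 \<Rightarrow> 'a" where "c2 z = 81 * z ^ 3 - 108 * z ^ 2 + 30 * z"
definition c1 :: "'a::comm_ring_1 \<Rightarrow> 'a" where "c1 z = 9 * z ^ 2 - 12 * z"

text \<open>The characteristic equation of (1 + u + u^2)^4 over polynomials in u^3; as 1 + u + u^2 =
  (1 - u^3) / (1 - u) has norm (1 - u^3)^2, the last term is an eighth power.\<close>

lemma cubic_poly_identity:
  fixes u :: "'a::idom"
  shows "((1 + u + u ^ 2) ^ 4) ^ 3 =
    (81 - 108 * (1 - u ^ 3) + 30 * (1 - u ^ 3) ^ 2) * ((1 + u + u ^ 2) ^ 4) ^ 2 +
    (9 * (1 - u ^ 3) ^ 4 - 12 * (1 - u ^ 3) ^ 5) * (1 + u + u ^ 2) ^ 4 + (1 - u ^ 3) ^ 8"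
  by algebra

theorem modular_equation: "y ^ 3 = V (c2 y) * y ^ 2 + V (c1 y) * y + V y"
proof -
  define z where "z = V y"
  define n where "n = (1 + t + t ^ 2) ^ 4"
  define s where "s = 1 - t ^ 3"
  have zs: "z * s = 1" unfolding z_def s_def by (rule Vy_t)
  have y: "y = z ^ 3 * n" unfolding z_def n_def by (rule y_eq)
  have n: "n ^ 3 = (81 - 108 * s + 30 * s ^ 2) * n ^ 2 + (9 * s ^ 4 - 12 * s ^ 5) * n + s ^ 8"
    unfolding n_def s_def by (rule cubic_poly_identity)
  have zk: "z ^ k * s ^ k = 1" for k
    using zs by (simp flip: power_mult_distrib)
  have "y ^ 3 = z ^ 9 * n ^ 3"
    unfolding y by (simp add: power_mult_distrib flip: power_mult)
  \<comment> \<open>The inserted factors z^k s^k = 1 absorb every power of s.\<close>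
  also have "\<dots> = (81 * z ^ 3 - 108 * z ^ 2 * (z ^ 1 * s ^ 1) + 30 * z * (z ^ 2 * s ^ 2)) * (z ^ 3 * n) ^ 2 +
     (9 * z ^ 2 * (z ^ 4 * s ^ 4) - 12 * z * (z ^ 5 * s ^ 5)) * (z ^ 3 * n) + z * (z ^ 8 * s ^ 8)"
    unfolding n by (simp add: algebra_simps eval_nat_numeral)
  also have "\<dots> = c2 z * y ^ 2 + c1 z * y + z"
    unfolding zk y c2_def c1_def by simp
  finally have "y ^ 3 = c2 z * y ^ 2 + c1 z * y + z" .
  moreover have "c2 z = V (c2 y)" "c1 z = V (c1 y)"
    by (simp_all add: z_def c2_def c1_def)
  ultimately show ?thesis
    by (simp only: z_def)
qed

text \<open>The cubic equation divided by y: only y, 1 and 1 / y then have to be evaluated under an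
  operator.\<close>

lemma y_square: "y ^ 2 = V (c2 y) * y + V (c1 y) + V y * (V y * (1 - t) ^ 4)"
proof -
  define w where "w = V y * (1 - t) ^ 4"
  have w: "y * w = 1" unfolding w_def by (rule y_inverse)
  have "y ^ 2 = y ^ 3 * w"
    using w by (simp add: eval_nat_numeral mult.assoc)
  also have "\<dots> = V (c2 y) * y * (y * w) + V (c1 y) * (y * w) + V y * w"
    unfolding modular_equation by (simp add: algebra_simps power2_eq_square)
  finally show ?thesis unfolding w by (simp add: w_def)
qed

section \<open>Values of the operators on 1, y, y^2\<close>

text \<open>Powers of t have exponents in a single class modulo 3, so an expansion in t over series
  in q^3 is a 3-dissection up to powers of \<open>tau\<close>.\<close>

lemma D_t_dissection:
  assumes "f = V a + t * V b + t ^ 2 * V c"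
  shows "D 0 f = a" "D 2 f = tau ^ 2 * c"
proof -
  have "f = V a + fps_X * V (tau * b) + fps_X ^ 2 * V (tau ^ 2 * c)"
    unfolding assms by (simp add: t_def algebra_simps power_mult_distrib)
  from dissection_eqI[OF this] show "D 0 f = a" "D 2 f = tau ^ 2 * c" by simp_all
qed

definition T :: "rat fps" where "T = fps_X * tau ^ 3"

lemma t_cube: "t ^ 3 = V T"
  unfolding T_def by (rule V_T[symmetric])

lemma y_T: "y * T = y - 1"
  using y_tau by (simp add: T_def algebra_simps)

lemma D_0_1: "D 0 1 = 1"
  using dissection_eqI(1)[of 1 1 0 0] by simp

text \<open>Sort (1 + t + t^2)^4 by the exponent of t modulo 3; the prefactor y^3 then suffices to
  remove T through y T = y - 1.\<close>

lemma D_0_y: "D 0 y = 27 * y ^ 3 - 36 * y ^ 2 + 10 * y"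
proof -
  have "(1 + t + t ^ 2) ^ 4 = V (1 + 16 * T + 10 * T ^ 2) + t * V (4 + 19 * T + 4 * T ^ 2) +
     t ^ 2 * V (10 + 16 * T + T ^ 2)"
    unfolding V_simps t_cube[symmetric] by (simp add: algebra_simps eval_nat_numeral)
  from D_t_dissection(1)[OF this] have "D 0 ((1 + t + t ^ 2) ^ 4) = 1 + 16 * T + 10 * T ^ 2" .
  hence "D 0 y = y ^ 3 * (1 + 16 * T + 10 * T ^ 2)"
    by (subst y_eq) (simp flip: V_simps(5) add: D_V_mult)
  also have "\<dots> = 27 * y ^ 3 - 36 * y ^ 2 + 10 * y"
    using y_T by algebra
  finally show ?thesis .
qed

lemma D_0_y_inverse: "D 0 (V y * (1 - t) ^ 4) = 4 - 3 * y"
proof -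
  have "(1 - t) ^ 4 = V (1 - 4 * T) + t * V (T - 4) + t ^ 2 * V 6"
    unfolding V_simps t_cube[symmetric] by (simp add: algebra_simps eval_nat_numeral)
  from D_t_dissection(1)[OF this] have "D 0 (V y * (1 - t) ^ 4) = y * (1 - 4 * T)"
    by (simp add: D_V_mult)
  also have "\<dots> = 4 - 3 * y"
    using y_T by algebra
  finally show ?thesis .
qed

lemma D_0_y_square: "D 0 (y ^ 2) = c2 y * D 0 y + c1 y + y * (4 - 3 * y)"
proof -
  have "D 0 (V (c1 y)) = c1 y"
    using D_V_mult[of 0 "c1 y" 1] by (simp add: D_0_1)
  thus ?thesis
    unfolding y_square by (simp add: D_V_mult D_0_y_inverse)
qed

text \<open>Since \<open>psi = V (V psi / tau) * (t + 2)\<close> and \<open>phi = V (V phi) * (1 - t)\<close>, this is the operator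
  for which \<open>D 2 (Gfps * f) = V Gfps * H f\<close>.\<close>
definition H :: "rat fps \<Rightarrow> rat fps" where
  "H f = inverse tau ^ 2 * y * D 2 ((t + 2) ^ 2 * (1 + t + t ^ 2) * f)"

lemma H_add: "H (f + h) = H f + H h"
  by (simp add: H_def algebra_simps)

lemma H_V_mult: "H (V a * f) = a * H f"
proof -
  have "(t + 2) ^ 2 * (1 + t + t ^ 2) * (V a * f) = V a * ((t + 2) ^ 2 * (1 + t + t ^ 2) * f)"
    by (simp only: mult_ac)
  hence "D 2 ((t + 2) ^ 2 * (1 + t + t ^ 2) * (V a * f)) = a * D 2 ((t + 2) ^ 2 * (1 + t + t ^ 2) * f)"
    by (simp only: D_V_mult order_refl)
  thus ?thesis unfolding H_def by (simp only: mult_ac)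
qed

lemma tau_nth_0: "fps_nth tau 0 \<noteq> 0"
proof -
  have "fps_nth (tau * V phi) 0 = 2"
    unfolding tau_V_phi by simp
  thus ?thesis by auto
qed

lemma H_dissection:
  assumes "(t + 2) ^ 2 * (1 + t + t ^ 2) * f = V a + t * V b + t ^ 2 * V c"
  shows "H f = y * c"
proof -
  have "inverse tau ^ 2 * tau ^ 2 = 1"
    using tau_nth_0 by (simp add: inverse_mult_eq_1 flip: power_mult_distrib)
  thus ?thesis
    unfolding H_def D_t_dissection(2)[OF assms] by (simp add: mult_ac)
qed

text \<open>The 9 is the coefficient of t^2 in (t + 2)^2 (1 + t + t^2); it is the whole gain for
  \<alpha> = 1.\<close>

lemma H_1: "H 1 = 9 * y"
proof -
  have "(t + 2) ^ 2 * (1 + t + t ^ 2) * 1 = V (4 + 5 * T) + t * V (8 + T) + t ^ 2 * V 9"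
    unfolding V_simps t_cube[symmetric] by (simp add: algebra_simps eval_nat_numeral)
  from H_dissection[OF this] show ?thesis by simp
qed

lemma H_y: "H y = 729 * y ^ 4 - 891 * y ^ 3 + 252 * y ^ 2 - 9 * y"
proof -
  have "(t + 2) ^ 2 * (1 + t + t ^ 2) * (1 + t + t ^ 2) ^ 4 =
    V (4 + 185 * T + 429 * T ^ 2 + 110 * T ^ 3 + T ^ 4) + t * V (24 + 315 * T + 351 * T ^ 2 + 39 * T ^ 3) +
     t ^ 2 * V (81 + 414 * T + 225 * T ^ 2 + 9 * T ^ 3)"
    unfolding V_simps t_cube[symmetric] by algebra
  from H_dissection[OF this]
  have "H ((1 + t + t ^ 2) ^ 4) = y * (81 + 414 * T + 225 * T ^ 2 + 9 * T ^ 3)" .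
  hence "H y = y ^ 3 * (y * (81 + 414 * T + 225 * T ^ 2 + 9 * T ^ 3))"
    by (subst y_eq) (simp flip: V_simps(5) add: H_V_mult)
  also have "\<dots> = 729 * y ^ 4 - 891 * y ^ 3 + 252 * y ^ 2 - 9 * y"
    using y_T by algebra
  finally show ?thesis .
qed

text \<open>By \<open>y_inverse\<close>, the argument is \<open>1 / y\<close>; this value starts the recursion backwards, which is cheaper
  than expanding \<open>y ^ 2\<close>.\<close>
lemma H_y_inverse: "H (V y * (1 - t) ^ 4) = 1"
proof -
  have "(t + 2) ^ 2 * (1 + t + t ^ 2) * (1 - t) ^ 4 =
    V ((1 - T) * (4 + 5 * T)) + t * V ((1 - T) * (- 8 - T)) + t ^ 2 * V ((1 - T) * (1 - T))"
    unfolding V_simps t_cube[symmetric] by algebra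
  from H_dissection[OF this] have "H (V y * (1 - t) ^ 4) = (y * (1 - T)) ^ 2"
    by (simp add: H_V_mult power2_eq_square mult_ac)
  also have "y * (1 - T) = 1"
    using y_T by (simp add: algebra_simps)
  finally show ?thesis by simp
qed

lemma H_y_square: "H (y ^ 2) = c2 y * H y + c1 y * (9 * y) + y"
proof -
  have "H (V (c1 y)) = c1 y * (9 * y)"
    using H_V_mult[of "c1 y" 1] by (simp add: H_1)
  thus ?thesis
    unfolding y_square H_add H_V_mult[of "c2 y"] H_V_mult[of y "V y * (1 - t) ^ 4"] H_y_inverse by simp
qed

section \<open>\<open>psi\<close> and \<open>Gfps\<close> in terms of t\<close>

lemma psi_dissection: "psi = V (theta 1 1 2) + fps_X * V (V psi)"
proof -
  have "(2 * psi) * Eq 1 = theta 1 0 1 * Eq 1"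
    using psi_Eq theta_psi by (simp add: mult.assoc)
  hence th: "theta 1 0 1 = 2 * psi" by simp
  have "2 * psi = 2 * (V (theta 1 1 2) + fps_X * V (V psi))"
    using theta_psi_dissection unfolding th by (simp add: algebra_simps)
  thus ?thesis by (metis mult_cancel_left zero_neq_numeral)
qed

text \<open>This product relation is why the dissections of \<open>psi\<close> and
  \<open>phi\<close> involve the same t.\<close>

lemma theta_1_2_omega: "theta 1 1 2 * omega = V psi * V phi"
proof -
  have 1: "V psi * Eq 3 = Eq 6 ^ 2" "V phi * Eq 6 = Eq 3 ^ 2"
    using arg_cong[OF psi_Eq, of V] arg_cong[OF phi_Eq, of V] by (simp_all add: V_Eq)
  have "theta 1 1 2 * omega * (Eq 1 * Eq 6 * (Eq 2 * Eq 3)) =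
    (theta 1 1 2 * (Eq 1 * Eq 6)) * (omega * (Eq 2 * Eq 3))"
    by (simp only: mult_ac)
  also have "\<dots> = Eq 1 * Eq 2 * (Eq 3 ^ 2 * Eq 6 ^ 2)"
    unfolding theta_1_2 omega_Eq by (simp only: mult_ac)
  also have "\<dots> = V psi * V phi * (Eq 1 * Eq 6 * (Eq 2 * Eq 3))"
    unfolding 1[symmetric] by (simp only: mult_ac)
  finally show ?thesis by simp
qed

lemma psi_eq_t: "psi = V (V psi * inverse tau) * (t + 2)"
proof -
  have it: "inverse tau * tau = 1"
    using tau_nth_0 by (rule inverse_mult_eq_1)
  have "theta 1 1 2 * tau * V phi = 2 * (theta 1 1 2 * omega)"
    using tau_V_phi by (simp add: mult_ac)
  hence "theta 1 1 2 * tau = 2 * V psi"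
    unfolding theta_1_2_omega by (simp add: mult.assoc)
  hence "theta 1 1 2 = 2 * V psi * inverse tau"
    using it by (metis mult.assoc mult.commute mult_1)
  hence "psi = V (2 * V psi * inverse tau) + fps_X * V (V psi * (inverse tau * tau))"
    using psi_dissection by (simp add: it)
  thus ?thesis
    by (simp add: t_def algebra_simps)
qed

lemma Gfps_Eq: "Gfps * Eq 1 ^ 4 = Eq 2 ^ 5"
  by (simp add: Gfps_def fps_divide_unit fps_power_zeroth mult.assoc inverse_mult_eq_1)

lemma Gfps_phi: "Gfps * phi = psi ^ 2"
proof -
  have "Gfps * phi * (Eq 1 ^ 4 * Eq 2) = (Gfps * Eq 1 ^ 4) * (phi * Eq 2)"
    by (simp only: mult_ac)
  also have "\<dots> = Eq 1 ^ 2 * Eq 2 * (Eq 2 ^ 2) ^ 2"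
    unfolding Gfps_Eq phi_Eq by (simp add: eval_nat_numeral mult_ac)
  also have "\<dots> = psi ^ 2 * (Eq 1 ^ 4 * Eq 2)"
    unfolding psi_Eq[symmetric] by (simp add: eval_nat_numeral mult_ac)
  finally show ?thesis by simp
qed

text \<open>In psi^2 / phi both series are known in t, and 1 / (1 - t) equals V y (1 + t + t^2) by
  \<open>Vy_t\<close>.\<close>

lemma Gfps_eq_t: "Gfps = V (V Gfps * inverse tau ^ 2 * y) * ((t + 2) ^ 2 * (1 + t + t ^ 2))"
proof -
  have VG: "V (V Gfps) * V (V phi) = V (V psi) ^ 2"
    using arg_cong[OF Gfps_phi, of "\<lambda>f. V (V f)"] by simp
  have "Gfps * (1 - t) * V (V phi) = Gfps * phi"
    by (subst phi_eq_t) (simp only: mult_ac)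
  also have "\<dots> = (V (V psi * inverse tau) * (t + 2)) ^ 2"
    unfolding Gfps_phi by (subst psi_eq_t) rule
  also have "\<dots> = V (V psi) ^ 2 * V (inverse tau) ^ 2 * (t + 2) ^ 2"
    by (simp add: power_mult_distrib)
  also have "\<dots> = V (V Gfps) * V (inverse tau) ^ 2 * (t + 2) ^ 2 * V (V phi)"
    unfolding VG[symmetric] by (simp only: mult_ac)
  finally have *: "Gfps * (1 - t) = V (V Gfps) * V (inverse tau) ^ 2 * (t + 2) ^ 2" by simp
  have "Gfps = Gfps * (V y * (1 - t ^ 3))"
    by (simp add: Vy_t)
  also have "1 - t ^ 3 = (1 - t) * (1 + t + t ^ 2)"
    by (simp add: algebra_simps eval_nat_numeral)
  also have "Gfps * (V y * ((1 - t) * (1 + t + t ^ 2))) = Gfps * (1 - t) * V y * (1 + t + t ^ 2)"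
    by (simp only: mult_ac)
  finally show ?thesis
    unfolding * by (simp add: mult_ac)
qed

lemma D_2_Gfps_mult: "D 2 (Gfps * f) = V Gfps * H f"
proof -
  have "D 2 (Gfps * f) =
      D 2 (V (V Gfps * inverse tau ^ 2 * y) * ((t + 2) ^ 2 * (1 + t + t ^ 2) * f))"
    by (subst Gfps_eq_t) (simp only: mult_ac)
  also have "\<dots> = V Gfps * H f"
    unfolding D_V_mult[OF order_refl] H_def by (simp only: mult_ac)
  finally show ?thesis .
qed

subsection \<open>Integral lattices of polynomials in \<open>Y = 3 * y\<close>\<close>

text \<open>The ring Z[x] in Horner form: induction peels off one factor x, as the recursion
  requires, and inversion reads off the constant term.\<close>

inductive_set int_polys :: "'a::comm_ring_1 \<Rightarrow> 'a set" for x where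
  zero: "0 \<in> int_polys x"
| horner: "a \<in> int_polys x \<Longrightarrow> of_int c + x * a \<in> int_polys x"

lemma int_polys_of_int [simp]: "of_int c \<in> int_polys x"
  using horner[OF zero, of c x] by simp

lemma int_polys_1 [simp]: "1 \<in> int_polys x"
  using int_polys_of_int[of 1] by simp

lemma int_polys_numeral [simp]: "numeral k \<in> int_polys x"
  using int_polys_of_int[of "numeral k"] by simp

lemma int_polys_times_self: "a \<in> int_polys x \<Longrightarrow> x * a \<in> int_polys x"
  using horner[of a x 0] by simp

lemma int_polys_self [simp]: "x \<in> int_polys x"
  using int_polys_times_self[OF int_polys_1] by simp

lemma int_polys_add:
  assumes "a \<in> int_polys x" "b \<in> int_polys x"
  shows "a + b \<in> int_polys x"
  using assms
proof (induction arbitrary: b)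
  case (horner a c)
  from horner.prems show ?case
  proof cases
    case zero
    then show ?thesis using horner.hyps by (simp add: int_polys.horner)
  next
    case (horner b' d)
    have "of_int (c + d) + x * (a + b') \<in> int_polys x"
      by (intro int_polys.horner horner.IH horner)
    thus ?thesis using horner by (simp add: algebra_simps)
  qed
qed simp

lemma int_polys_scale: "a \<in> int_polys x \<Longrightarrow> of_int c * a \<in> int_polys x"
proof (induction rule: int_polys.induct)
  case (horner a d)
  have "of_int (c * d) + x * (of_int c * a) \<in> int_polys x"
    by (intro int_polys.horner horner.IH)
  thus ?case by (simp add: algebra_simps)
qed (simp add: zero)

lemma int_polys_mult:
  assumes "a \<in> int_polys x" "b \<in> int_polys x"
  shows "a * b \<in> int_polys x"
  using assms(1)
proof (induction rule: int_polys.induct)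
  case (horner a c)
  have "of_int c * b + x * (a * b) \<in> int_polys x"
    by (intro int_polys_add int_polys_scale int_polys_times_self assms horner.IH)
  thus ?case by (simp add: algebra_simps)
qed (simp add: zero)

lemma int_polys_uminus: "a \<in> int_polys x \<Longrightarrow> - a \<in> int_polys x"
  using int_polys_scale[of a x "- 1"] by simp

lemma int_polys_diff: "a \<in> int_polys x \<Longrightarrow> b \<in> int_polys x \<Longrightarrow> a - b \<in> int_polys x"
  using int_polys_add[of a x "- b"] int_polys_uminus[of b x] by simp

lemma int_polys_power: "a \<in> int_polys x \<Longrightarrow> a ^ n \<in> int_polys x"
  by (induction n) (simp_all add: int_polys_mult)

lemmas int_polys_intros = int_polys_add int_polys_diff int_polys_mult int_polys_uminus int_polys_power
  int_polys_self int_polys_numeral int_polys_of_int int_polys_1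

lemma V_of_int [simp]: "V (of_int c) = of_int c"
  by (simp flip: fps_of_int)

definition Y :: "rat fps" where "Y = 3 * y"

text \<open>\<open>d2\<close> and \<open>d1\<close> are \<open>c2 y\<close> and \<open>c1 y\<close>
  rewritten in Y.\<close>

definition d2 :: "rat fps" where "d2 = 3 * Y ^ 3 - 12 * Y ^ 2 + 10 * Y"
definition d1 :: "rat fps" where "d1 = Y ^ 2 - 4 * Y"

lemma Y_cube: "Y ^ 3 = V (3 * d2) * Y ^ 2 + V (9 * d1) * Y + V (9 * Y)"
proof -
  have "Y ^ 3 = 27 * y ^ 3"
    by (simp add: Y_def power_mult_distrib)
  also have "\<dots> = 27 * V (c2 y) * y ^ 2 + 27 * V (c1 y) * y + 27 * V y"
    unfolding modular_equation by (simp add: algebra_simps)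
  also have "\<dots> = V (3 * d2) * Y ^ 2 + V (9 * d1) * Y + V (9 * Y)"
    by (simp add: Y_def d2_def d1_def c2_def c1_def algebra_simps power_mult_distrib)
  finally show ?thesis .
qed

lemma d_int_polys: "d2 \<in> int_polys Y" "d1 \<in> int_polys Y"
  unfolding d2_def d1_def by (intro int_polys_intros)+

text \<open>Shared by \<open>D 0\<close> and \<open>H\<close>. The outer factor 3 is what
  \<open>D_0_lattice\<close> divides out.\<close>

lemma operator_Y_cube:
  assumes add: "\<And>f h. F (f + h) = F f + F h" and lin: "\<And>a f. F (V a * f) = a * F f"
  shows "F (Y * (Y ^ 2 * f)) = 3 * (d2 * F (Y ^ 2 * f) + 3 * d1 * F (Y * f) + 3 * Y * F f)"
proof -
  have "Y * (Y ^ 2 * f) = Y ^ 3 * f"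
    by (simp add: eval_nat_numeral mult_ac)
  also have "\<dots> = V (3 * d2) * (Y ^ 2 * f) + V (9 * d1) * (Y * f) + V (9 * Y) * f"
    unfolding Y_cube by (simp add: algebra_simps)
  finally have "F (Y * (Y ^ 2 * f)) = 3 * d2 * F (Y ^ 2 * f) + 9 * d1 * F (Y * f) + 9 * Y * F f"
    by (simp only: add lin)
  thus ?thesis by (simp add: algebra_simps)
qed

text \<open>The recursion has order three, so three consecutive values are carried along. The
  generator m allows a common factor: 1 for \<open>D 0\<close>, 3 Y for \<open>H\<close>.\<close>

lemma operator_int_polys:
  assumes add: "\<And>f h. F (f + h) = F f + F h" and lin: "\<And>a f. F (V a * f) = a * F f"
    and M: "M = (*) m ` int_polys Y"
    and base: "F 1 \<in> M" "F Y \<in> M" "F (Y ^ 2) \<in> M"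
    and f: "f \<in> int_polys Y"
  shows "F f \<in> M \<and> F (Y * f) \<in> M \<and> F (Y ^ 2 * f) \<in> M"
  using f
proof (induction rule: int_polys.induct)
  case zero
  have "F 0 = 0" using lin[of 0 0] by simp
  moreover have "0 \<in> M" unfolding M by (rule image_eqI[of _ _ 0]) (simp_all add: int_polys.zero)
  ultimately show ?case by simp
next
  case (horner f c)
  have M_add: "u + v \<in> M" if "u \<in> M" "v \<in> M" for u v
    using that unfolding M by (auto simp: image_iff simp flip: distrib_left intro: int_polys_add)
  have M_mult: "u * v \<in> M" if "u \<in> int_polys Y" "v \<in> M" for u v
    using that unfolding M by (auto simp: image_iff intro!: int_polys_mult bexI[of _ "u * _"])
  have step: "F (h * (of_int c + Y * f)) = of_int c * F h + F (Y * (h * f))" for h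
    using lin[of "of_int c" h] add[of "of_int c * h" "Y * (h * f)"] by (simp add: algebra_simps)
  have "F (Y * (Y ^ 2 * f)) \<in> M"
    unfolding operator_Y_cube[of F, OF add lin]
    by (intro M_mult M_add int_polys_intros d_int_polys) (use horner.IH in auto)
  moreover have "F (Y * (Y * f)) \<in> M"
    using horner.IH by (simp add: power2_eq_square mult.assoc)
  ultimately show ?case
    using step[of 1] step[of Y] step[of "Y ^ 2"] horner.IH base
    by (auto intro!: M_add M_mult)
qed

lemma D_0_int_polys:
  assumes "f \<in> int_polys Y"
  shows "D 0 f \<in> int_polys Y"
proof -
  have Y1: "D 0 Y = 10 * Y - 12 * Y ^ 2 + 3 * Y ^ 3"
  proof -
    have "D 0 Y = 3 * D 0 y"
      using D_V_mult[of 0 3 y] by (simp add: Y_def)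
    thus ?thesis by (simp add: D_0_y Y_def algebra_simps power_mult_distrib)
  qed
  have Y2: "D 0 (Y ^ 2) = 3 * d2 * D 0 Y + 9 * d1 + 3 * Y * (4 - Y)"
  proof -
    have "D 0 (Y ^ 2) = 9 * D 0 (y ^ 2)"
      using D_V_mult[of 0 9 "y ^ 2"] by (simp add: Y_def power_mult_distrib)
    thus ?thesis
      unfolding D_0_y_square Y1
      by (simp add: D_0_y Y_def d2_def d1_def c2_def c1_def algebra_simps power_mult_distrib)
  qed
  have "D 0 f \<in> (*) 1 ` int_polys Y"
    by (rule operator_int_polys[THEN conjunct1, OF _ _ refl _ _ _ assms])
       (auto simp: D_V_mult D_0_1 Y1 Y2 intro!: int_polys_intros d_int_polys)
  thus ?thesis by simp
qed

lemma H_int_polys: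
  assumes "f \<in> int_polys Y"
  shows "H f \<in> (*) (3 * Y) ` int_polys Y"
proof -
  have H0: "H 1 = (3 * Y) * 1"
    by (simp add: H_1 Y_def)
  have H1: "H Y = (3 * Y) * (9 * Y ^ 3 - 33 * Y ^ 2 + 28 * Y - 3)"
  proof -
    have "H Y = 3 * H y"
      using H_V_mult[of 3 y] by (simp add: Y_def)
    thus ?thesis by (simp add: H_y Y_def algebra_simps eval_nat_numeral)
  qed
  have H2: "H (Y ^ 2) = (3 * Y) * (3 * d2 * (9 * Y ^ 3 - 33 * Y ^ 2 + 28 * Y - 3) + 9 * d1 + 1)"
  proof -
    have "H (Y ^ 2) = 9 * H (y ^ 2)"
      using H_V_mult[of 9 "y ^ 2"] by (simp add: Y_def power_mult_distrib)
    thus ?thesis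
      unfolding H_y_square
      by (simp add: H_y Y_def d2_def d1_def c2_def c1_def algebra_simps eval_nat_numeral)
  qed
  have "H 1 \<in> (*) (3 * Y) ` int_polys Y" "H Y \<in> (*) (3 * Y) ` int_polys Y"
    "H (Y ^ 2) \<in> (*) (3 * Y) ` int_polys Y"
    unfolding H0 H1 H2 by (intro imageI int_polys_intros d_int_polys)+
  thus ?thesis
    by (intro operator_int_polys[THEN conjunct1, OF H_add H_V_mult refl _ _ _ assms])
qed

text \<open>The coefficient of \<open>y ^ k\<close> is divisible by \<open>3 ^ (k - 1)\<close> for \<open>k \<ge> 3\<close>, but not for \<open>k = 2\<close>: already for
  \<open>\<alpha> = 2\<close> that coefficient is a unit at 3.\<close>
inductive_set odd_lattice :: "rat fps set" where
  "p \<in> int_polys Y \<Longrightarrow> of_int a * y + of_int b * y ^ 2 + 9 * y ^ 3 * p \<in> odd_lattice"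

text \<open>Now the coefficient of y^k is divisible by 3^k for every k >= 2, and only that of y is
  free.\<close>

inductive_set even_lattice :: "rat fps set" where
  "p \<in> int_polys Y \<Longrightarrow> of_int a * y + Y * p \<in> even_lattice"

lemma even_latticeI:
  "p \<in> int_polys Y \<Longrightarrow> f = of_int a * y + Y * p \<Longrightarrow> f \<in> even_lattice"
  using even_lattice.intros by simp

lemma odd_latticeI:
  "p \<in> int_polys Y \<Longrightarrow> f = of_int a * y + of_int b * y ^ 2 + 9 * y ^ 3 * p \<Longrightarrow> f \<in> odd_lattice"
  using odd_lattice.intros by simp

text \<open>Since 9 y^3 p = Y^3 p / 3, the recursion's factor 3 cancels the denominator and leaves
  an integral polynomial divisible by Y; y and y^2 are evaluated directly.\<close>

lemma D_0_lattice:
  assumes "f \<in> odd_lattice"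
  shows "D 0 f \<in> even_lattice"
  using assms
proof cases
  case (1 p a b)
  define r where "r = d2 * D 0 (Y ^ 2 * p) + 3 * d1 * D 0 (Y * p) + 3 * Y * D 0 p"
  have cube: "D 0 (9 * y ^ 3 * p) = r"
  proof -
    have "3 * D 0 (9 * y ^ 3 * p) = D 0 (V 3 * (9 * y ^ 3 * p))"
      by (rule D_V_mult[symmetric]) simp
    also have "V 3 * (9 * y ^ 3 * p) = Y * (Y ^ 2 * p)"
      by (simp add: Y_def power_mult_distrib eval_nat_numeral)
    also have "D 0 \<dots> = 3 * r"
      unfolding r_def by (rule operator_Y_cube) (simp_all add: D_V_mult)
    finally show ?thesis by simp
  qed
  have y1: "D 0 y = 10 * y + Y * (- 4 * Y + Y ^ 2)"
    unfolding D_0_y by (simp add: Y_def algebra_simps eval_nat_numeral)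
  have y2: "D 0 (y ^ 2) = - 8 * y + Y * (34 * Y - 80 * Y ^ 2 + 68 * Y ^ 3 - 24 * Y ^ 4 + 3 * Y ^ 5)"
    unfolding D_0_y_square D_0_y c2_def c1_def Y_def by algebra
  define r' where "r' = (3 * Y ^ 2 - 12 * Y + 10) * D 0 (Y ^ 2 * p) + 3 * (Y - 4) * D 0 (Y * p) + 3 * D 0 p"
  have r: "r = Y * r'"
    unfolding r_def r'_def d2_def d1_def by (simp add: algebra_simps eval_nat_numeral)
  have lin: "D 0 (of_int c * h) = of_int c * D 0 h" for c h
    using D_V_mult[of 0 "of_int c" h] by simp
  show ?thesis
  proof (rule even_latticeI)
    show "of_int a * (- 4 * Y + Y ^ 2) +
      of_int b * (34 * Y - 80 * Y ^ 2 + 68 * Y ^ 3 - 24 * Y ^ 4 + 3 * Y ^ 5) + r' \<in> int_polys Y"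
      unfolding r'_def using 1 by (intro int_polys_intros D_0_int_polys)
    show "D 0 f = of_int (10 * a - 8 * b) * y + Y * (of_int a * (- 4 * Y + Y ^ 2) +
      of_int b * (34 * Y - 80 * Y ^ 2 + 68 * Y ^ 3 - 24 * Y ^ 4 + 3 * Y ^ 5) + r')"
      unfolding 1(1) D_add lin cube y1 y2 r by (simp add: algebra_simps)
  qed
qed

text \<open>H y is divisible by 9. On Y^2 p' the operator gives 3 Y q, and 3 Y = 9 y, 3 Y^2 = 27
  y^2, 3 Y^3 = 81 y^3 supply the 9 and the shape of \<open>odd_lattice\<close>.\<close>

lemma H_lattice:
  assumes "f \<in> even_lattice"
  obtains h where "h \<in> odd_lattice" "H f = 9 * h"
  using assms
proof cases
  case (1 p a)
  have lin: "H (of_int c * h) = of_int c * H h" for c h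
    using H_V_mult[of "of_int c" h] by simp
  from 1(2) obtain p' c where p: "p' \<in> int_polys Y" "p = of_int c + Y * p'"
  proof cases
    case zero
    then show ?thesis using that[of 0 0] by (simp add: int_polys.zero)
  qed auto
  have "H (Y ^ 2 * p') \<in> (*) (3 * Y) ` int_polys Y"
    by (intro H_int_polys int_polys_intros p)
  then obtain q where q: "q \<in> int_polys Y" "H (Y ^ 2 * p') = 3 * Y * q" by auto
  obtain q1 c0 where q1: "q1 \<in> int_polys Y" "q = of_int c0 + Y * q1"
    using q(1)
  proof cases
    case zero
    then show ?thesis using that[of 0 0] by (simp add: int_polys.zero)
  qed auto
  obtain q2 c1 where q2: "q2 \<in> int_polys Y" "q1 = of_int c1 + Y * q2"
    using q1(1)
  proof cases
    case zero
    then show ?thesis using that[of 0 0] by (simp add: int_polys.zero)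
  qed auto
  define e where "e = a + 3 * c"
  have f: "f = of_int e * y + Y ^ 2 * p'"
    unfolding 1(1) p(2) e_def by (simp add: Y_def algebra_simps power2_eq_square)
  have "H f = of_int e * H y + 3 * Y * (of_int c0 + Y * (of_int c1 + Y * q2))"
    unfolding f H_add lin q(2) q1(2) q2(2) ..
  also have "\<dots> = 9 * (of_int (c0 - e) * y + of_int (28 * e + 3 * c1) * y ^ 2 +
      9 * y ^ 3 * (of_int e * (3 * Y - 11) + q2))"
    unfolding H_y by (simp add: Y_def algebra_simps eval_nat_numeral)
  finally have "H f = \<dots>" .
  moreover have "of_int (c0 - e) * y + of_int (28 * e + 3 * c1) * y ^ 2 +
      9 * y ^ 3 * (of_int e * (3 * Y - 11) + q2) \<in> odd_lattice"
    by (intro odd_lattice.intros int_polys_intros q2)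
  ultimately show ?thesis using that by blast
qed

subsection \<open>Integrality and the induction\<close>

definition int_fps :: "rat fps set" where "int_fps = {f. \<forall>n. fps_nth f n \<in> \<int>}"

lemma int_fps_add: "f \<in> int_fps \<Longrightarrow> h \<in> int_fps \<Longrightarrow> f + h \<in> int_fps"
  by (simp add: int_fps_def)

lemma int_fps_mult: "f \<in> int_fps \<Longrightarrow> h \<in> int_fps \<Longrightarrow> f * h \<in> int_fps"
  by (auto simp: int_fps_def fps_mult_nth intro!: Ints_sum Ints_mult)

lemma int_fps_of_int: "of_int c \<in> int_fps"
  by (auto simp: int_fps_def simp flip: fps_of_int)

lemma int_fps_power: "f \<in> int_fps \<Longrightarrow> f ^ n \<in> int_fps"
  using int_fps_of_int[of 1] by (induction n) (auto intro: int_fps_mult)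

lemma int_fps_numeral: "numeral k \<in> int_fps"
  using int_fps_of_int[of "numeral k"] by simp

lemma int_fps_V: "f \<in> int_fps \<Longrightarrow> V f \<in> int_fps"
  by (simp add: int_fps_def V_nth)

lemma int_fps_inverse:
  assumes "f \<in> int_fps" "fps_nth f 0 = 1"
  shows "inverse f \<in> int_fps"
proof -
  have "fps_nth (inverse f) n \<in> \<int>" for n
  proof (induction n rule: less_induct)
    case (less n)
    show ?case
    proof (cases "n = 0")
      case False
      have "f * inverse f = 1"
        using assms(2) by (simp add: inverse_mult_eq_1')
      hence "0 = fps_nth (f * inverse f) n"
        using False by simp
      also have "\<dots> = fps_nth (inverse f) n + (\<Sum>i=1..n. fps_nth f i * fps_nth (inverse f) (n - i))"
        by (simp add: fps_mult_nth sum.atLeast_Suc_atMost assms(2))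
      finally have "fps_nth (inverse f) n = - (\<Sum>i=1..n. fps_nth f i * fps_nth (inverse f) (n - i))"
        by simp
      also have "\<dots> \<in> \<int>"
        using assms(1) by (auto simp: int_fps_def intro!: Ints_minus Ints_sum Ints_mult less.IH)
      finally show ?thesis .
    qed (simp add: assms(2))
  qed
  thus ?thesis by (simp add: int_fps_def)
qed

lemma int_fps_Eq: "Eq a \<in> int_fps"
proof -
  have "1 - fps_X ^ k \<in> int_fps" for k
    by (auto simp: int_fps_def fps_X_power_nth)
  hence "(\<Prod>k\<in>A. 1 - fps_X ^ (a * k)) \<in> int_fps" for A
    using int_fps_of_int[of 1] by (induction A rule: infinite_finite_induct) (auto intro: int_fps_mult)
  thus ?thesis by (simp add: int_fps_def Eq_def)
qed

lemma int_fps_y: "y \<in> int_fps"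
proof -
  have "phi \<in> int_fps"
    by (auto simp: int_fps_def phi_def theta_nth intro!: Ints_sum Ints_power)
  thus ?thesis
    unfolding y_def by (intro int_fps_mult int_fps_power int_fps_V int_fps_inverse) auto
qed

lemma int_fps_Gfps: "Gfps \<in> int_fps"
proof -
  have "Gfps = Eq 2 ^ 5 * inverse (Eq 1 ^ 4)"
    by (simp add: Gfps_def fps_divide_unit fps_power_zeroth)
  also have "\<dots> \<in> int_fps"
    by (intro int_fps_mult int_fps_power int_fps_inverse int_fps_Eq) (simp add: fps_power_zeroth)
  finally show ?thesis .
qed

lemma int_polys_subset_int_fps: "p \<in> int_polys Y \<Longrightarrow> p \<in> int_fps"
proof (induction rule: int_polys.induct)
  case zero
  show ?case using int_fps_of_int[of 0] by simp
next
  case (horner a c)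
  thus ?case unfolding Y_def
    by (intro int_fps_add int_fps_mult int_fps_of_int int_fps_numeral int_fps_y)
qed

lemma odd_lattice_subset_int_fps: "f \<in> odd_lattice \<Longrightarrow> f \<in> int_fps"
  by (elim odd_lattice.cases) (simp add: int_fps_add int_fps_mult int_fps_of_int int_fps_numeral
      int_fps_power int_fps_y int_polys_subset_int_fps)

text \<open>One step of the induction is \<open>D 0\<close> followed by \<open>D 2\<close>, sending
  \<open>odd_lattice\<close> through \<open>even_lattice\<close> back to \<open>odd_lattice\<close>
  with a gain of 9.\<close>

lemma progression_series:
  "\<exists>h\<in>odd_lattice. Abs_fps (\<lambda>n. g (3 ^ (2 * k + 1) * n + (3 ^ (2 * k + 2) - 1) div 4)) =
     9 ^ Suc k * (V Gfps * h)"
proof (induction k)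
  case 0
  have "Abs_fps (\<lambda>n. g (3 ^ (2 * 0 + 1) * n + (3 ^ (2 * 0 + 2) - 1) div 4)) = D 2 (Gfps * 1)"
    by (simp add: fps_eq_iff g_def)
  also have "\<dots> = 9 ^ Suc 0 * (V Gfps * y)"
    unfolding D_2_Gfps_mult H_1 by simp
  moreover have "y \<in> odd_lattice"
    by (rule odd_latticeI[OF int_polys.zero, of _ 1 0]) simp
  ultimately show ?case by metis
next
  case (Suc k)
  define s where "s k = Abs_fps (\<lambda>n. g (3 ^ (2 * k + 1) * n + (3 ^ (2 * k + 2) - 1) div 4))" for k
  from Suc.IH obtain h where h: "h \<in> odd_lattice" "s k = 9 ^ Suc k * (V Gfps * h)"
    unfolding s_def by blast
  from H_lattice[OF D_0_lattice[OF h(1)]] obtain h' where h': "h' \<in> odd_lattice" "H (D 0 h) = 9 * h'"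
    by blast
  have "s (Suc k) = D 2 (D 0 (s k))"
  proof (rule fps_ext)
    fix n
    define N :: nat where "N = 3 ^ (2 * k + 1)"
    \<comment> \<open>Both divisions by 4 in the index are exact because 9^j is 1 modulo 4.\<close>
    have "9 ^ j mod 4 = (1 :: nat)" for j
    proof (induction j)
      case (Suc j)
      have "9 * x mod 4 = 1" if "x mod 4 = 1" for x :: nat
        using that by presburger
      with Suc.IH show ?case by (simp only: power_Suc)
    qed simp
    moreover have "3 * N = 9 ^ Suc k"
      by (simp add: N_def power_mult)
    ultimately have "3 * N mod 4 = 1" by (simp only:)
    hence "N * (3 * (3 * n + 2) + 0) + (3 * N - 1) div 4 = 9 * N * n + (27 * N - 1) div 4"
    proof -
      assume *: "3 * N mod 4 = 1"
      define M where "M = 3 * N div 4"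
      have "3 * N = 4 * M + 1" using * unfolding M_def by presburger
      moreover have "27 * N = 8 * (3 * N) + 3 * N" by simp
      ultimately have "27 * N = 4 * (6 * N + M) + 1" "3 * N = 4 * M + 1" by simp_all
      hence "(27 * N - 1) div 4 = 6 * N + M" "(3 * N - 1) div 4 = M" by simp_all
      thus ?thesis by (simp add: algebra_simps)
    qed
    moreover have "3 ^ (2 * k + 2) = 3 * N" "3 ^ (2 * Suc k + 1) = 9 * N" "3 ^ (2 * Suc k + 2) = 27 * N"
      by (simp_all add: N_def)
    ultimately show "fps_nth (s (Suc k)) n = fps_nth (D 2 (D 0 (s k))) n"
      by (simp only: s_def D_nth fps_nth_Abs_fps N_def [symmetric])
  qed
  \<comment> \<open>\<open>D 0\<close> turns the factor \<open>V Gfps\<close> into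
    \<open>Gfps\<close>, on which \<open>D 2\<close> acts through \<open>H\<close>.\<close>
  also have "D 0 (s k) = V (9 ^ Suc k) * (Gfps * D 0 h)"
  proof -
    have "s k = V (9 ^ Suc k * Gfps) * h"
      by (simp add: h(2) mult.assoc)
    hence "D 0 (s k) = 9 ^ Suc k * Gfps * D 0 h"
      using D_V_mult[of 0 "9 ^ Suc k * Gfps" h] by (simp only: le0)
    thus ?thesis by (simp add: mult.assoc)
  qed
  also have "D 2 \<dots> = 9 ^ Suc k * (V Gfps * (9 * h'))"
    by (simp only: D_V_mult order_refl D_2_Gfps_mult h'(2))
  also have "\<dots> = 9 ^ Suc (Suc k) * (V Gfps * h')"
    by (simp add: mult_ac)
  finally show ?case
    using h'(1) unfolding s_def by blast
qed

theorem theorem3p4: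
  fixes \<alpha> n :: nat
  assumes "\<alpha> \<ge> 1"
  shows "\<exists>m::int. g (3 ^ (2 * \<alpha> - 1) * n + (3 ^ (2 * \<alpha>) - 1) div 4)
                   = of_int (3 ^ (2 * \<alpha>)) * of_int m"
proof -
  obtain k where \<alpha>: "\<alpha> = Suc k"
    using assms by (cases \<alpha>) auto
  obtain h where h: "h \<in> odd_lattice"
    "Abs_fps (\<lambda>n. g (3 ^ (2 * k + 1) * n + (3 ^ (2 * k + 2) - 1) div 4)) = 9 ^ Suc k * (V Gfps * h)"
    using progression_series by blast
  have "V Gfps * h \<in> int_fps"
    by (intro int_fps_mult int_fps_V int_fps_Gfps odd_lattice_subset_int_fps h)
  then obtain m where m: "fps_nth (V Gfps * h) n = of_int m"
    unfolding int_fps_def by (auto elim: Ints_cases)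
  have idx: "2 * \<alpha> - 1 = 2 * k + 1" "2 * \<alpha> = 2 * k + 2"
    by (simp_all add: \<alpha>)
  have "g (3 ^ (2 * k + 1) * n + (3 ^ (2 * k + 2) - 1) div 4) = fps_nth (9 ^ Suc k * (V Gfps * h)) n"
    using arg_cong[OF h(2), of "\<lambda>f. fps_nth f n"] by simp
  also have "(9 :: rat fps) ^ Suc k = fps_const (9 ^ Suc k)"
    by (simp only: numeral_fps_const fps_const_power)
  also have "fps_nth (fps_const (9 ^ Suc k) * (V Gfps * h)) n = 9 ^ Suc k * of_int m"
    by (simp only: fps_mult_left_const_nth m)
  also have "(9 :: rat) ^ Suc k = of_int (3 ^ (2 * k + 2))"
    by (simp add: power_mult)
  finally show ?thesis
    unfolding idx(1) unfolding idx(2) by blast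
qed

end
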